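(* Assume $d_1\neq 0$, and exclude from consideration the motions with $x=\mathrm{const}$ (that is, $\nu_1=\mathrm{const}$). The problem of motion of a heavy gyrostat with a fixed point in the Hess--Sretensky case is reduced to solving a second order linear homogeneous differential equation with rational coefficients, namely $$\frac{d^2u}{dx^2}+a(x)\frac{du}{dx}+b(x)u=0,\qquad a(x)=\frac{P_9(x)}{xP_6(x)P_3(x)},\quad b(x)=\frac{P_3(x)Q_3(x)}{4x^2P_6(x)},$$ where $$P_3(x)=2d_1x^3+(B-2A)x^2+2(Bh-p_1),\qquad Q_3(x)=4d_1x^3-P_3(x),$$ $$P_6(x)=x^6+(B^2-4h)x^4+4\bigl(h^2-1-B(Bh-p_1)\bigr)x^2+4(Bh-p_1)^2,$$ $$\begin{aligned}P_9(x)=\;&2d_1x^9+2(B-2A)x^8+(B^3+8Ah-2AB^2+4Bh-8p_1)x^6+8d_1(1-h^2-p_1B+hB^2)x^5\\&+6(B^2-4h)(Bh-p_1)x^4-16d_1(Bh-p_1)^2x^3\\&+\bigl(4(Bh-p_1)^2(2A-5B)+16(Bh-p_1)(h^2-1)\bigr)x^2+8(Bh-p_1)^3.\end{aligned}$$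
   Context: Gyrostat. In the principal axes of inertia $Ox_1x_2x_3$ at the fixed point $O$, let $A_1,A_2,A_3$ be the principal moments of inertia, $r_0=(x_1,x_2,x_3)$ the position of the center of mass, $s=(s_1,s_2,s_3)$ the constant gyrostatic momentum, $\omega$ the angular velocity of the carrier, $\gamma$ the unit upward vertical vector, $M$ the mass, $g$ the acceleration due to gravity, $\mathbb I=\mathrm{diag}(A_1,A_2,A_3)$. The Euler--Poisson equations are $$\mathbb I\dot\omega+\omega\times(\mathbb I\omega+s)=Mg\,\gamma\times r_0,\qquad \dot\gamma=\gamma\times\omega .$$ Hess--Sretensky case. The parameters satisfy $s_3=0$, $x_3=0$, $A_2(A_3-A_1)x_2^2=A_1(A_2-A_3)x_1^2$, $A_2\ge A_3\ge A_1$, and the motion lies on the invariant manifold $L_1=ck_2/b$, where, with $\rho=\sqrt{x_1^2+x_2^2}$, $$L_1=\frac{A_1\omega_1x_1+A_2\omega_2x_2}{\rho},\quad L_2=\frac{A_2\omega_2x_1-A_1\omega_1x_2}{\rho},\quad L_3=A_3\omega_3,\quad k_1=\frac{s_1x_1+s_2x_2}{\rho},\quad k_2=\frac{s_2x_1-s_1x_2}{\rho},$$ $$\nu_1=\frac{\gamma_1x_1+\gamma_2x_2}{\rho},\quad \nu_2=\frac{\gamma_2x_1-\gamma_1x_2}{\rho},\quad \nu_3=\gamma_3,$$ $$a=\frac{A_2x_1^2+A_1x_2^2}{A_1A_2\rho^2},\quad b=\frac{(A_1-A_2)x_1x_2}{A_1A_2\rho^2},\quad c=\frac1{A_3},\quad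 \Gamma=Mg\rho .$$ (These constants $a,b$ are not to be confused with the coefficient functions $a(x),b(x)$.) Dimensionless variables. Put $F=\frac{(ac-b^2)k_2}{b}$, $G=\frac{ck_2}{b}+k_1$, $y=(L_2+k_2)\sqrt{c/\Gamma}$, $z=L_3\sqrt{c/\Gamma}$, $\tau=t\sqrt{\Gamma c}$, $d_1=b/c$, $A=F/\sqrt{\Gamma c}$, $B=G\sqrt{c/\Gamma}$. On the invariant manifold the equations of motion become $$\frac{dy}{d\tau}=d_1yz+(A-B)z+\nu_3,\quad \frac{dz}{d\tau}=-d_1y^2-(A-B)y-\nu_2,$$ $$\frac{d\nu_1}{d\tau}=z\nu_2-y\nu_3,\quad \frac{d\nu_2}{d\tau}=d_1y\nu_3-z\nu_1+A\nu_3,\quad \frac{d\nu_3}{d\tau}=-d_1y\nu_2+y\nu_1-A\nu_2,$$ with first integrals $$\frac{y^2+z^2}{2}+\nu_1=h,\qquad y\nu_2+z\nu_3+B\nu_1=p_1,\qquad \nu_1^2+\nu_2^2+\nu_3^2=1,$$ which define the constants $h$ and $p_1$. The variables $x$ and $u$. Polar coordinates are introduced by $y=x\cos\varphi$, $z=x\sin\varphi$, and $\varphi$ is regarded as a function of $x$. With $w=\tan(\varphi/2)$ one gets the Riccati equation $\frac{dw}{dx}=f_2w^2+f_0$, $f_2=-\frac{P_3(x)}{2x\sqrt{-P_6(x)}}$, $f_0=\frac{Q_3(x)}{2x\sqrt{-P_6(x)}}$ (for a choice of sign of the square root), and $u(x)=\exp\left(-\int f_2w\,dx\right)$. *)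

theory Defs
  imports "HOL-Analysis.Analysis"
begin

record gyrostat =
  moments :: "real^3"
  center_of_mass :: "real^3"
  gyro_momentum :: "real^3"
  mass :: real
  gravity :: real

definition inertia :: "gyrostat \<Rightarrow> real^3 \<Rightarrow> real^3" where
  "inertia P v = (\<chi> i. moments P $ i * v $ i)"

definition euler_poisson ::
    "gyrostat \<Rightarrow> real set \<Rightarrow> (real \<Rightarrow> real^3) \<Rightarrow> (real \<Rightarrow> real^3) \<Rightarrow> bool" where
  "euler_poisson P T \<omega> \<gamma> \<longleftrightarrow>
     (\<forall>t\<in>T. \<exists>\<omega>' \<gamma>'.
        (\<omega> has_vector_derivative \<omega>') (at t) \<and>
        (\<gamma> has_vector_derivative \<gamma>') (at t) \<and>
        inertia P \<omega>' + cross3 (\<omega> t) (inertia P (\<omega> t) + gyro_momentum P)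
          = (mass P * gravity P) *\<^sub>R cross3 (\<gamma> t) (center_of_mass P) \<and>
        \<gamma>' = cross3 (\<gamma> t) (\<omega> t))"

definition hess_sretensky :: "gyrostat \<Rightarrow> bool" where
  "hess_sretensky P \<longleftrightarrow>
     mass P > 0 \<and> gravity P > 0 \<and> (\<forall>i. moments P $ i > 0) \<and>
     gyro_momentum P $ 3 = 0 \<and> center_of_mass P $ 3 = 0 \<and>
     moments P $ 2 * (moments P $ 3 - moments P $ 1) * (center_of_mass P $ 2)\<^sup>2
       = moments P $ 1 * (moments P $ 2 - moments P $ 3) * (center_of_mass P $ 1)\<^sup>2 \<and>
     moments P $ 2 \<ge> moments P $ 3 \<and> moments P $ 3 \<ge> moments P $ 1"

definition hs_rho :: "gyrostat \<Rightarrow> real" where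
  "hs_rho P = sqrt ((center_of_mass P $ 1)\<^sup>2 + (center_of_mass P $ 2)\<^sup>2)"

text \<open>Components of a vector along the direction to the center of mass and along the
  orthogonal direction in the plane of the first two principal axes.\<close>

definition comp1 :: "gyrostat \<Rightarrow> real^3 \<Rightarrow> real" where
  "comp1 P v = (v $ 1 * center_of_mass P $ 1 + v $ 2 * center_of_mass P $ 2) / hs_rho P"

definition comp2 :: "gyrostat \<Rightarrow> real^3 \<Rightarrow> real" where
  "comp2 P v = (v $ 2 * center_of_mass P $ 1 - v $ 1 * center_of_mass P $ 2) / hs_rho P"

definition hs_k1 :: "gyrostat \<Rightarrow> real" where
  "hs_k1 P = comp1 P (gyro_momentum P)"

definition hs_k2 :: "gyrostat \<Rightarrow> real" where
  "hs_k2 P = comp2 P (gyro_momentum P)"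

definition hs_a :: "gyrostat \<Rightarrow> real" where
  "hs_a P = (moments P $ 2 * (center_of_mass P $ 1)\<^sup>2 + moments P $ 1 * (center_of_mass P $ 2)\<^sup>2)
     / (moments P $ 1 * moments P $ 2 * (hs_rho P)\<^sup>2)"

definition hs_b :: "gyrostat \<Rightarrow> real" where
  "hs_b P = (moments P $ 1 - moments P $ 2) * center_of_mass P $ 1 * center_of_mass P $ 2
     / (moments P $ 1 * moments P $ 2 * (hs_rho P)\<^sup>2)"

definition hs_c :: "gyrostat \<Rightarrow> real" where
  "hs_c P = 1 / moments P $ 3"

definition hs_Gamma :: "gyrostat \<Rightarrow> real" where
  "hs_Gamma P = mass P * gravity P * hs_rho P"

definition hs_F :: "gyrostat \<Rightarrow> real" where
  "hs_F P = (hs_a P * hs_c P - (hs_b P)\<^sup>2) * hs_k2 P / hs_b P"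

definition hs_G :: "gyrostat \<Rightarrow> real" where
  "hs_G P = hs_c P * hs_k2 P / hs_b P + hs_k1 P"

definition hs_d1 :: "gyrostat \<Rightarrow> real" where
  "hs_d1 P = hs_b P / hs_c P"

definition hs_A :: "gyrostat \<Rightarrow> real" where
  "hs_A P = hs_F P / sqrt (hs_Gamma P * hs_c P)"

definition hs_B :: "gyrostat \<Rightarrow> real" where
  "hs_B P = hs_G P * sqrt (hs_c P / hs_Gamma P)"

definition hs_y :: "gyrostat \<Rightarrow> real^3 \<Rightarrow> real" where
  "hs_y P w = (comp2 P (inertia P w) + hs_k2 P) * sqrt (hs_c P / hs_Gamma P)"

definition hs_z :: "gyrostat \<Rightarrow> real^3 \<Rightarrow> real" where
  "hs_z P w = inertia P w $ 3 * sqrt (hs_c P / hs_Gamma P)"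

text \<open>The polar radius in the plane of the dimensionless variables \<open>(y, z)\<close>.\<close>

definition hs_x :: "gyrostat \<Rightarrow> real^3 \<Rightarrow> real" where
  "hs_x P w = sqrt ((hs_y P w)\<^sup>2 + (hs_z P w)\<^sup>2)"

definition hs_motion ::
    "gyrostat \<Rightarrow> real set \<Rightarrow> (real \<Rightarrow> real^3) \<Rightarrow> (real \<Rightarrow> real^3) \<Rightarrow> bool" where
  "hs_motion P T \<omega> \<gamma> \<longleftrightarrow>
     euler_poisson P T \<omega> \<gamma> \<and>
     (\<forall>t\<in>T. norm (\<gamma> t) = 1 \<and> comp1 P (inertia P (\<omega> t)) = hs_c P * hs_k2 P / hs_b P)"

definition hs_integrals ::
    "gyrostat \<Rightarrow> real \<Rightarrow> real \<Rightarrow> real set \<Rightarrow> (real \<Rightarrow> real^3) \<Rightarrow> (real \<Rightarrow> real^3) \<Rightarrow> bool" where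
  "hs_integrals P h p1 T \<omega> \<gamma> \<longleftrightarrow>
     (\<forall>t\<in>T. ((hs_y P (\<omega> t))\<^sup>2 + (hs_z P (\<omega> t))\<^sup>2) / 2 + comp1 P (\<gamma> t) = h \<and>
       hs_y P (\<omega> t) * comp2 P (\<gamma> t) + hs_z P (\<omega> t) * \<gamma> t $ 3 + hs_B P * comp1 P (\<gamma> t) = p1)"

definition hs_P3 :: "gyrostat \<Rightarrow> real \<Rightarrow> real \<Rightarrow> real \<Rightarrow> real" where
  "hs_P3 P h p1 x =
     2 * hs_d1 P * x^3 + (hs_B P - 2 * hs_A P) * x^2 + 2 * (hs_B P * h - p1)"

definition hs_Q3 :: "gyrostat \<Rightarrow> real \<Rightarrow> real \<Rightarrow> real \<Rightarrow> real" where
  "hs_Q3 P h p1 x = 4 * hs_d1 P * x^3 - hs_P3 P h p1 x"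

definition hs_P6 :: "gyrostat \<Rightarrow> real \<Rightarrow> real \<Rightarrow> real \<Rightarrow> real" where
  "hs_P6 P h p1 x =
     x^6 + ((hs_B P)^2 - 4 * h) * x^4 + 4 * (h^2 - 1 - hs_B P * (hs_B P * h - p1)) * x^2
       + 4 * (hs_B P * h - p1)^2"

definition hs_P9 :: "gyrostat \<Rightarrow> real \<Rightarrow> real \<Rightarrow> real \<Rightarrow> real" where
  "hs_P9 P h p1 x = (let d1 = hs_d1 P; A = hs_A P; B = hs_B P in
     2 * d1 * x^9 + 2 * (B - 2 * A) * x^8
     + (B^3 + 8 * A * h - 2 * A * B^2 + 4 * B * h - 8 * p1) * x^6
     + 8 * d1 * (1 - h^2 - p1 * B + h * B^2) * x^5
     + 6 * (B^2 - 4 * h) * (B * h - p1) * x^4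
     - 16 * d1 * (B * h - p1)^2 * x^3
     + (4 * (B * h - p1)^2 * (2 * A - 5 * B) + 16 * (B * h - p1) * (h^2 - 1)) * x^2
     + 8 * (B * h - p1)^3)"

definition hs_coeff_a :: "gyrostat \<Rightarrow> real \<Rightarrow> real \<Rightarrow> real \<Rightarrow> real" where
  "hs_coeff_a P h p1 x = hs_P9 P h p1 x / (x * hs_P6 P h p1 x * hs_P3 P h p1 x)"

definition hs_coeff_b :: "gyrostat \<Rightarrow> real \<Rightarrow> real \<Rightarrow> real \<Rightarrow> real" where
  "hs_coeff_b P h p1 x = hs_P3 P h p1 x * hs_Q3 P h p1 x / (4 * x^2 * hs_P6 P h p1 x)"

text \<open>The sign \<open>\<epsilon> \<in> {1, -1}\<close> selects the branch \<open>\<epsilon> * sqrt (- P6)\<close> of the square root.\<close>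

definition hs_f2 :: "gyrostat \<Rightarrow> real \<Rightarrow> real \<Rightarrow> real \<Rightarrow> real \<Rightarrow> real" where
  "hs_f2 P h p1 \<epsilon> x = - hs_P3 P h p1 x / (2 * x * (\<epsilon> * sqrt (- hs_P6 P h p1 x)))"

definition hs_f0 :: "gyrostat \<Rightarrow> real \<Rightarrow> real \<Rightarrow> real \<Rightarrow> real \<Rightarrow> real" where
  "hs_f0 P h p1 \<epsilon> x = hs_Q3 P h p1 x / (2 * x * (\<epsilon> * sqrt (- hs_P6 P h p1 x)))"

definition solves_linear_ode2 ::
    "real set \<Rightarrow> (real \<Rightarrow> real) \<Rightarrow> (real \<Rightarrow> real) \<Rightarrow> (real \<Rightarrow> real) \<Rightarrow> bool" where
  "solves_linear_ode2 X a b u \<longleftrightarrow>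
     (\<forall>x\<in>X. u field_differentiable at x \<and> deriv u field_differentiable at x \<and>
        deriv (deriv u) x + a x * deriv u x + b x * u x = 0)"

text \<open>Values of \<open>x\<close> at which the change of variables is regular. The condition \<open>P6 < 0\<close> means
  that \<open>dx/dt\<close> does not vanish, since \<open>4 x^2 (dx/d\<tau>)^2 = - P6\<close> along every motion.\<close>

definition hs_regular_x :: "gyrostat \<Rightarrow> real \<Rightarrow> real \<Rightarrow> real set" where
  "hs_regular_x P h p1 = {x. x > 0 \<and> hs_P6 P h p1 x < 0 \<and> hs_P3 P h p1 x \<noteq> 0}"

text \<open>The second condition says that the polar angle is not an odd multiple of \<open>\<pi>\<close>, so that
  \<open>w = tan (\<phi>/2)\<close> is finite.\<close>

definition hs_regular_times ::
    "gyrostat \<Rightarrow> real \<Rightarrow> real \<Rightarrow> real set \<Rightarrow> (real \<Rightarrow> real^3) \<Rightarrow> real set" where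
  "hs_regular_times P h p1 T \<omega> =
     {t\<in>T. hs_x P (\<omega> t) \<in> hs_regular_x P h p1 \<and> hs_y P (\<omega> t) \<noteq> - hs_x P (\<omega> t)}"

text \<open>The quadrature for \<open>x\<close>; the factor \<open>sqrt (\<Gamma> c)\<close> converts from the dimensionless time
  \<open>\<tau> = t sqrt (\<Gamma> c)\<close>. The minus sign matches the branch \<open>\<epsilon>\<close> used in \<open>f2\<close> and \<open>f0\<close>.\<close>

definition hs_quadrature ::
    "gyrostat \<Rightarrow> real \<Rightarrow> real \<Rightarrow> real \<Rightarrow> real set \<Rightarrow> (real \<Rightarrow> real) \<Rightarrow> bool" where
  "hs_quadrature P h p1 \<epsilon> J \<xi> \<longleftrightarrow>
     (\<forall>t\<in>J. (\<xi> has_real_derivative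
        sqrt (hs_Gamma P * hs_c P) * (- (\<epsilon> * sqrt (- hs_P6 P h p1 (\<xi> t))) / (2 * \<xi> t))) (at t))"

definition hs_polar_angle ::
    "gyrostat \<Rightarrow> real set \<Rightarrow> (real \<Rightarrow> real^3) \<Rightarrow> (real \<Rightarrow> real) \<Rightarrow> bool" where
  "hs_polar_angle P J \<omega> \<phi> \<longleftrightarrow>
     (\<forall>t\<in>J. hs_y P (\<omega> t) = hs_x P (\<omega> t) * cos (\<phi> (hs_x P (\<omega> t))) \<and>
        hs_z P (\<omega> t) = hs_x P (\<omega> t) * sin (\<phi> (hs_x P (\<omega> t))))"

text \<open>The solution of the Riccati equation belonging to a solution \<open>u\<close> of the linear equation,
  obtained by inverting \<open>u = exp (- \<integral> f2 w dx)\<close>.\<close>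

definition hs_w_of_u ::
    "gyrostat \<Rightarrow> real \<Rightarrow> real \<Rightarrow> real \<Rightarrow> (real \<Rightarrow> real) \<Rightarrow> real \<Rightarrow> real" where
  "hs_w_of_u P h p1 \<epsilon> u x = - deriv u x / (hs_f2 P h p1 \<epsilon> x * u x)"

text \<open>The motion with constants \<open>h\<close>, \<open>p1\<close> whose polar radius is \<open>\<xi>\<close> and whose polar angle
  is \<open>\<phi> = 2 arctan w\<close>, where \<open>w\<close> comes from \<open>u\<close>.\<close>

definition hs_recovered ::
    "gyrostat \<Rightarrow> real \<Rightarrow> real \<Rightarrow> real \<Rightarrow> (real \<Rightarrow> real) \<Rightarrow> real set \<Rightarrow> (real \<Rightarrow> real) \<Rightarrow>
     (real \<Rightarrow> real^3) \<Rightarrow> (real \<Rightarrow> real^3) \<Rightarrow> bool" where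
  "hs_recovered P h p1 \<epsilon> u J \<xi> \<omega> \<gamma> \<longleftrightarrow>
     hs_motion P J \<omega> \<gamma> \<and> hs_integrals P h p1 J \<omega> \<gamma> \<and>
     (\<forall>t\<in>J. hs_y P (\<omega> t) = \<xi> t * cos (2 * arctan (hs_w_of_u P h p1 \<epsilon> u (\<xi> t))) \<and>
        hs_z P (\<omega> t) = \<xi> t * sin (2 * arctan (hs_w_of_u P h p1 \<epsilon> u (\<xi> t))))"

text \<open>The passage from a motion to the linear equation on a time interval \<open>J\<close> of regular times.
  The angle is determined only up to multiples of \<open>2\<pi>\<close> and the antiderivative \<open>U\<close> up to a
  constant; the reduction holds for every choice.\<close>

definition hs_reduction ::
    "gyrostat \<Rightarrow> real \<Rightarrow> real \<Rightarrow> real set \<Rightarrow> (real \<Rightarrow> real^3) \<Rightarrow> (real \<Rightarrow> real^3) \<Rightarrow> bool" where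
  "hs_reduction P h p1 J \<omega> \<gamma> \<longleftrightarrow>
     (let x = (\<lambda>t. hs_x P (\<omega> t)); X = x ` J in
      inj_on x J \<and> open X \<and> is_interval X \<and>
      (\<exists>\<epsilon>\<in>{1, -1}.
         hs_quadrature P h p1 \<epsilon> J x \<and>
         (\<exists>\<phi>. continuous_on X \<phi> \<and> hs_polar_angle P J \<omega> \<phi>) \<and>
         (\<forall>\<phi>. hs_polar_angle P J \<omega> \<phi> \<longrightarrow>
            (let w = (\<lambda>\<xi>. tan (\<phi> \<xi> / 2)) in
             (\<forall>\<xi>\<in>X. (w has_real_derivative
                (hs_f2 P h p1 \<epsilon> \<xi> * (w \<xi>)\<^sup>2 + hs_f0 P h p1 \<epsilon> \<xi>)) (at \<xi>)) \<and>
             (\<exists>U. \<forall>\<xi>\<in>X. (U has_real_derivative hs_f2 P h p1 \<epsilon> \<xi> * w \<xi>) (at \<xi>)) \<and>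
             (\<forall>U. (\<forall>\<xi>\<in>X. (U has_real_derivative hs_f2 P h p1 \<epsilon> \<xi> * w \<xi>) (at \<xi>)) \<longrightarrow>
                (let u = (\<lambda>\<xi>. exp (- U \<xi>)) in
                 solves_linear_ode2 X (hs_coeff_a P h p1) (hs_coeff_b P h p1) u \<and>
                 (\<forall>\<xi>\<in>X. w \<xi> = hs_w_of_u P h p1 \<epsilon> u \<xi>) \<and>
                 hs_recovered P h p1 \<epsilon> u J x \<omega> \<gamma>))))))"

end

(*
  In the orthonormal frame adapted to the center of mass the equations on the invariant manifold
  become an autonomous system for (y, z, nu1, nu2, nu3). With m = z nu2 - y nu3, which is dnu1/dtau,
  the integrals give 4 m^2 = - P6(x) and x dx/dtau = - m; hence x solves a quadrature, and the half
  angle tangent z / (x + y) has a derivative that is quadratic in itself with coefficients depending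
  on x only. This is the Riccati equation, linearised by w = - u' / (f2 u), where - f2'/f2 = a and
  f2 f0 = b. Conversely, w and m determine nu2 and nu3 by rotating the pair (p1 - B nu1, m) by the
  polar angle.
  Regular times are dense because nu1 is either constant or nowhere locally constant, and because
  z has nonzero derivative where the polar angle is pi.
*)
theory Submission
  imports Defs
begin

subsection \<open>The equations of motion in the frame of the center of mass\<close>

text \<open>The adapted frame works because of one coincidence. By the Hess relation the inverse
  inertia tensor has the same entry c in the second and third diagonal places, and the value of L1
  on the manifold absorbs k2. So the angular velocity and the total angular momentum have parallel
  projections orthogonal to the direction of the center of mass. The angular speed of (y, z) is
  affine in cos \<phi> with coefficients depending on x, which is why the half angle gives a Riccati
  equation, and one without linear term. Although \<open>f2\<close> and \<open>f0\<close> contain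
  the root of - P6, only the logarithmic derivative of \<open>f2\<close> and the product
  \<open>f2 * f0\<close> enter the linear equation; there the root and the sign \<epsilon>
  disappear. The obstacle is that \<phi> is a function of x only where x is monotone, while the
  linear equation is singular at the roots of x P3 P6. Hence the reduction is made on intervals of
  regular times, and density shows that the excluded times have empty interior.\<close>

lemma vec3_eq_iff: "u = v \<longleftrightarrow> u $ 1 = v $ 1 \<and> u $ 2 = v $ 2 \<and> u $ 3 = v $ 3"
  for u v :: "real^3"
  by (simp add: vec_eq_iff forall_3)

lemma has_vector_derivative_vec3:
  fixes f :: "real \<Rightarrow> real^3"
  shows "(f has_vector_derivative v) (at t) \<longleftrightarrow>
    (\<forall>i\<in>{1,2,3}. ((\<lambda>t. f t $ i) has_real_derivative v $ i) (at t))"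
proof -
  have "(f has_vector_derivative v) (at t) \<longleftrightarrow>
      (\<forall>i. ((\<lambda>t. f t $ i) has_vector_derivative v $ i) (at t))"
    unfolding has_vector_derivative_def
    by (subst has_derivative_componentwise_within)
      (auto simp: Basis_vec_def inner_axis)
  then show ?thesis
    by (simp add: forall_3 has_real_derivative_iff_has_vector_derivative)
qed

lemma vector_component_simps:
  "comp1 P (u + v) = comp1 P u + comp1 P v" "comp1 P (k *\<^sub>R u) = k * comp1 P u"
  "comp2 P (u + v) = comp2 P u + comp2 P v" "comp2 P (k *\<^sub>R u) = k * comp2 P u"
  by (simp_all add: comp1_def comp2_def algebra_simps add_divide_distrib diff_divide_distrib)

text \<open>The dimensionless equations written in physical time: the factor \<sigma> stands for
  d\<tau>/dt, so no motion has to be reparametrised.\<close>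

definition reduced_system ::
  "real \<Rightarrow> real \<Rightarrow> real \<Rightarrow> real \<Rightarrow> real set \<Rightarrow> (real \<Rightarrow> real) \<Rightarrow> (real \<Rightarrow> real) \<Rightarrow>
    (real \<Rightarrow> real) \<Rightarrow> (real \<Rightarrow> real) \<Rightarrow> (real \<Rightarrow> real) \<Rightarrow> bool" where
  "reduced_system \<sigma> d A B T y z n1 n2 n3 \<longleftrightarrow> (\<forall>t\<in>T.
     (y has_real_derivative \<sigma> * (d * y t * z t + (A - B) * z t + n3 t)) (at t) \<and>
     (z has_real_derivative \<sigma> * (- d * (y t)\<^sup>2 - (A - B) * y t - n2 t)) (at t) \<and>
     (n1 has_real_derivative \<sigma> * (z t * n2 t - y t * n3 t)) (at t) \<and>
     (n2 has_real_derivative \<sigma> * (d * y t * n3 t - z t * n1 t + A * n3 t)) (at t) \<and>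
     (n3 has_real_derivative \<sigma> * (- d * y t * n2 t + y t * n1 t - A * n2 t)) (at t))"

text \<open>A nonzero d1 gives b \<noteq> 0, so that the manifold value c k2 / b makes sense, it
  forces the center of mass off the fixed point, and it keeps \<open>hs_P3\<close> from vanishing
  identically.\<close>

locale hess_sretensky_gyrostat =
  fixes P :: gyrostat
  assumes hs: "hess_sretensky P" and d1_nonzero: "hs_d1 P \<noteq> 0"
begin

abbreviation "d \<equiv> hs_d1 P"
abbreviation "A \<equiv> hs_A P"
abbreviation "B \<equiv> hs_B P"
text \<open>Angular velocities are measured in units of \<open>\<sigma>\<close>, angular momenta in
  units of \<open>1 / \<mu>\<close>.\<close>

definition "\<sigma> = sqrt (hs_Gamma P * hs_c P)"
definition "\<mu> = sqrt (hs_c P / hs_Gamma P)"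

lemma moments_pos: "moments P $ i > 0"
  using hs by (simp add: hess_sretensky_def)

lemma b_nonzero: "hs_b P \<noteq> 0"
  using d1_nonzero by (auto simp: hs_d1_def)

lemma rho_pos: "hs_rho P > 0"
  using b_nonzero unfolding hs_b_def hs_rho_def
  by (auto simp: add_nonneg_eq_0_iff intro!: add_pos_nonneg)

lemma rho_sq: "(hs_rho P)\<^sup>2 = (center_of_mass P $ 1)\<^sup>2 + (center_of_mass P $ 2)\<^sup>2"
  by (simp add: hs_rho_def)

lemma c_pos: "hs_c P > 0"
  by (simp add: hs_c_def moments_pos)

lemma Gamma_pos: "hs_Gamma P > 0"
  using hs rho_pos by (simp add: hs_Gamma_def hess_sretensky_def)

lemma \<sigma>_pos: "\<sigma> > 0" and \<mu>_pos: "\<mu> > 0"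
  using c_pos Gamma_pos by (simp_all add: \<sigma>_def \<mu>_def)

lemma \<sigma>_\<mu>: "\<sigma> * \<mu> = hs_c P" "hs_Gamma P * \<mu> = \<sigma>"
proof -
  show "\<sigma> * \<mu> = hs_c P"
    using c_pos Gamma_pos
    by (simp add: \<sigma>_def \<mu>_def real_sqrt_mult real_sqrt_divide)
  have "hs_Gamma P * \<mu> = sqrt (hs_Gamma P * hs_Gamma P * (hs_c P / hs_Gamma P))"
    using Gamma_pos unfolding \<mu>_def real_sqrt_mult[of "hs_Gamma P * hs_Gamma P"] by simp
  then show "hs_Gamma P * \<mu> = \<sigma>"
    using Gamma_pos by (simp add: \<sigma>_def)
qed

lemma center_of_mass_components:
  "comp1 P (center_of_mass P) = hs_rho P" "comp2 P (center_of_mass P) = 0"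
  "center_of_mass P $ 3 = 0"
  using rho_pos hs
  by (simp_all add: comp1_def comp2_def hess_sretensky_def power2_eq_square[symmetric]
      rho_sq[symmetric]) (simp add: power2_eq_square)

text \<open>\<open>comp1\<close> and \<open>comp2\<close> are coordinates after a rotation about the
  third axis; the inverse is the transposed rotation.\<close>

lemma components_inverse:
  "v $ 1 = (comp1 P v * center_of_mass P $ 1 - comp2 P v * center_of_mass P $ 2) / hs_rho P"
  "v $ 2 = (comp1 P v * center_of_mass P $ 2 + comp2 P v * center_of_mass P $ 1) / hs_rho P"
proof -
  let ?x = "center_of_mass P $ 1" and ?y = "center_of_mass P $ 2" and ?r = "hs_rho P"
  have "comp1 P v * ?x - comp2 P v * ?y = v $ 1 * (?x\<^sup>2 + ?y\<^sup>2) / ?r"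
    "comp1 P v * ?y + comp2 P v * ?x = v $ 2 * (?x\<^sup>2 + ?y\<^sup>2) / ?r"
    by (simp_all add: comp1_def comp2_def power2_eq_square diff_divide_distrib
        add_divide_distrib algebra_simps)
  then show "v $ 1 = (comp1 P v * ?x - comp2 P v * ?y) / ?r"
    "v $ 2 = (comp1 P v * ?y + comp2 P v * ?x) / ?r"
    unfolding rho_sq[symmetric] using rho_pos by (simp_all add: power2_eq_square)
qed

lemma eq_iff_components:
  "u = v \<longleftrightarrow> comp1 P u = comp1 P v \<and> comp2 P u = comp2 P v \<and> u $ 3 = v $ 3"
  unfolding vec3_eq_iff by (metis components_inverse comp1_def comp2_def)

lemma norm_components: "(norm v)\<^sup>2 = (comp1 P v)\<^sup>2 + (comp2 P v)\<^sup>2 + (v $ 3)\<^sup>2"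
proof -
  let ?x = "center_of_mass P $ 1" and ?y = "center_of_mass P $ 2" and ?r = "hs_rho P"
  have "(comp1 P v)\<^sup>2 + (comp2 P v)\<^sup>2 = ((v $ 1)\<^sup>2 + (v $ 2)\<^sup>2) * (?x\<^sup>2 + ?y\<^sup>2) / ?r\<^sup>2"
    by (simp add: comp1_def comp2_def power_divide add_divide_distrib[symmetric])
      (simp add: power2_eq_square algebra_simps)
  also have "\<dots> = (v $ 1)\<^sup>2 + (v $ 2)\<^sup>2"
    unfolding rho_sq[symmetric] using rho_pos by simp
  finally show ?thesis
    by (simp add: norm_vec_def L2_set_def sum_3)
qed

text \<open>A rotation about the third axis preserves orientation, so the cross product keeps its
  coordinate form in the adapted frame.\<close>

lemma cross3_components:
  "comp1 P (cross3 u v) = comp2 P u * v $ 3 - u $ 3 * comp2 P v"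
  "comp2 P (cross3 u v) = u $ 3 * comp1 P v - comp1 P u * v $ 3"
  "cross3 u v $ 3 = comp1 P u * comp2 P v - comp2 P u * comp1 P v"
proof -
  let ?x = "center_of_mass P $ 1" and ?y = "center_of_mass P $ 2" and ?r = "hs_rho P"
  show "comp1 P (cross3 u v) = comp2 P u * v $ 3 - u $ 3 * comp2 P v"
    "comp2 P (cross3 u v) = u $ 3 * comp1 P v - comp1 P u * v $ 3"
    using rho_pos by (simp_all add: comp1_def comp2_def cross3_def field_simps)
  have "comp1 P u * comp2 P v - comp2 P u * comp1 P v
      = (u $ 1 * v $ 2 - u $ 2 * v $ 1) * (?x\<^sup>2 + ?y\<^sup>2) / ?r\<^sup>2"
    by (simp add: comp1_def comp2_def power2_eq_square diff_divide_distrib[symmetric])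
      (simp add: algebra_simps)
  also have "\<dots> = u $ 1 * v $ 2 - u $ 2 * v $ 1"
    unfolding rho_sq[symmetric] using rho_pos by simp
  finally show "cross3 u v $ 3 = comp1 P u * comp2 P v - comp2 P u * comp1 P v"
    by (simp add: cross3_def)
qed

text \<open>In the adapted frame the inverse inertia tensor has diagonal a, c, c and the single
  off-diagonal entry b. This is the origin of the constants \<open>hs_a\<close>,
  \<open>hs_b\<close>, \<open>hs_c\<close>.\<close>

lemma angular_velocity_components:
  "comp1 P w = hs_a P * comp1 P (inertia P w) + hs_b P * comp2 P (inertia P w)"
  "comp2 P w = hs_b P * comp1 P (inertia P w) + hs_c P * comp2 P (inertia P w)"
  "w $ 3 = hs_c P * inertia P w $ 3"
proof -
  let ?x = "center_of_mass P $ 1" and ?y = "center_of_mass P $ 2" and ?r = "hs_rho P"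
  let ?A1 = "moments P $ 1" and ?A2 = "moments P $ 2" and ?A3 = "moments P $ 3"
  have pos: "?A1 > 0" "?A2 > 0" "?A3 > 0" "?r > 0"
    using moments_pos rho_pos by auto
  define p q where "p = comp1 P (inertia P w)" and "q = comp2 P (inertia P w)"
  have w1: "w $ 1 = (p * ?x - q * ?y) / (?r * ?A1)"
    using components_inverse(1)[of "inertia P w"] pos
    by (simp add: p_def q_def inertia_def field_simps)
  have w2: "w $ 2 = (p * ?y + q * ?x) / (?r * ?A2)"
    using components_inverse(2)[of "inertia P w"] pos
    by (simp add: p_def q_def inertia_def field_simps)
  have "comp1 P w = (?x\<^sup>2 * ?A2 + ?y\<^sup>2 * ?A1) / (?A1 * ?A2 * ?r\<^sup>2) * p
       + (?A1 - ?A2) * ?x * ?y / (?A1 * ?A2 * ?r\<^sup>2) * q"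
    unfolding comp1_def w1 w2 using pos by (simp add: field_simps power2_eq_square)
  then show "comp1 P w = hs_a P * comp1 P (inertia P w) + hs_b P * comp2 P (inertia P w)"
    by (simp add: hs_a_def hs_b_def p_def q_def mult.commute)
  \<comment> \<open>The Hess relation between the moments and the center of mass, rearranged: it
    makes the second diagonal entry equal to 1 / A3.\<close>
  have "?A3 * (?A2 * ?y\<^sup>2 + ?A1 * ?x\<^sup>2) = ?A1 * ?A2 * ?r\<^sup>2"
    using hs unfolding rho_sq hess_sretensky_def by (simp add: algebra_simps)
  then have c: "hs_c P = (?A2 * ?y\<^sup>2 + ?A1 * ?x\<^sup>2) / (?A1 * ?A2 * ?r\<^sup>2)"
    using pos by (simp add: hs_c_def field_simps)
  have "comp2 P w = (?A1 - ?A2) * ?x * ?y / (?A1 * ?A2 * ?r\<^sup>2) * p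
       + (?A2 * ?y\<^sup>2 + ?A1 * ?x\<^sup>2) / (?A1 * ?A2 * ?r\<^sup>2) * q"
    unfolding comp2_def w1 w2 using pos by (simp add: field_simps power2_eq_square)
  then show "comp2 P w = hs_b P * comp1 P (inertia P w) + hs_c P * comp2 P (inertia P w)"
    by (simp add: c hs_b_def p_def q_def)
  show "w $ 3 = hs_c P * inertia P w $ 3"
    using pos by (simp add: hs_c_def inertia_def)
qed

text \<open>On the invariant manifold the angular velocity and the total angular momentum become
  affine in \<open>(y, z)\<close>.\<close>

lemma manifold_components:
  assumes "comp1 P (inertia P w) = hs_c P * hs_k2 P / hs_b P"
  shows "comp1 P w = \<sigma> * (A + d * hs_y P w)" "comp2 P w = \<sigma> * hs_y P w"
    "w $ 3 = \<sigma> * hs_z P w"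
    "comp1 P (inertia P w + gyro_momentum P) = B / \<mu>"
    "comp2 P (inertia P w + gyro_momentum P) = hs_y P w / \<mu>"
    "(inertia P w + gyro_momentum P) $ 3 = hs_z P w / \<mu>"
proof -
  define q where "q = comp2 P (inertia P w)"
  have y: "hs_y P w = (q + hs_k2 P) * \<mu>" and z: "hs_z P w = inertia P w $ 3 * \<mu>"
    by (simp_all add: hs_y_def hs_z_def \<mu>_def q_def)
  have c: "hs_c P \<noteq> 0" "\<sigma> \<noteq> 0" "\<mu> \<noteq> 0"
    using c_pos \<sigma>_pos \<mu>_pos by auto
  have "\<sigma> * A = hs_F P"
    using c(2) by (simp add: hs_A_def \<sigma>_def)
  \<comment> \<open>\<open>hs_F P\<close> is the constant term of a L1 + b L2 once L2 is written as
    y / \<mu> - k2.\<close>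
  moreover have "hs_F P = hs_a P * (hs_c P * hs_k2 P / hs_b P) - hs_b P * hs_k2 P"
    using b_nonzero by (simp add: hs_F_def power2_eq_square diff_divide_distrib left_diff_distrib)
  moreover have "\<sigma> * (d * hs_y P w) = hs_b P * (q + hs_k2 P)"
  proof -
    have "\<sigma> * (d * hs_y P w) = (\<sigma> * \<mu>) * d * (q + hs_k2 P)"
      by (simp add: y)
    also have "\<sigma> * \<mu> * d = hs_b P"
      using c by (simp add: \<sigma>_\<mu>(1) hs_d1_def)
    finally show ?thesis .
  qed
  ultimately show "comp1 P w = \<sigma> * (A + d * hs_y P w)"
    unfolding angular_velocity_components(1)[of w] assms q_def[symmetric] distrib_left[of \<sigma>]
    by (simp add: distrib_left)
  \<comment> \<open>On the manifold b L1 = c k2, so the second component of the angular velocity is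
    c times that of the total angular momentum, as for the third component.\<close>
  have "\<sigma> * hs_y P w = (\<sigma> * \<mu>) * (q + hs_k2 P)"
    by (simp add: y)
  also have "\<dots> = hs_c P * q + hs_c P * hs_k2 P"
    unfolding \<sigma>_\<mu>(1) by (simp add: distrib_left)
  finally show "comp2 P w = \<sigma> * hs_y P w"
    using b_nonzero unfolding angular_velocity_components(2)[of w] assms q_def[symmetric]
    by simp
  show "w $ 3 = \<sigma> * hs_z P w"
    unfolding angular_velocity_components(3)[of w] z by (simp add: \<sigma>_\<mu>(1)[symmetric])
  show "comp1 P (inertia P w + gyro_momentum P) = B / \<mu>"
    using c assms by (simp add: vector_component_simps hs_B_def \<mu>_def hs_G_def hs_k1_def)
  show "comp2 P (inertia P w + gyro_momentum P) = hs_y P w / \<mu>"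
    using c by (simp add: vector_component_simps y q_def hs_k2_def)
  show "(inertia P w + gyro_momentum P) $ 3 = hs_z P w / \<mu>"
    using c hs by (simp add: z hess_sretensky_def)
qed

text \<open>The second and third components of the angular velocity and of the total momentum are
  proportional with one factor, so their cross product has no first component; neither has the
  torque. Hence the first equation only says that L1 is stationary. The equivalence serves both
  directions, from a motion to the reduced system and back.\<close>

lemma euler_poisson_components_iff:
  assumes "comp1 P (inertia P w) = hs_c P * hs_k2 P / hs_b P"
  shows "inertia P w' + cross3 w (inertia P w + gyro_momentum P)
          = (mass P * gravity P) *\<^sub>R cross3 g (center_of_mass P) \<and> g' = cross3 g w \<longleftrightarrow>
    comp1 P (inertia P w') = 0 \<and>
    comp2 P (inertia P w') * \<mu>
      = \<sigma> * (d * hs_y P w * hs_z P w + (A - B) * hs_z P w + g $ 3) \<and>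
    inertia P w' $ 3 * \<mu> = \<sigma> * (- d * (hs_y P w)\<^sup>2 - (A - B) * hs_y P w - comp2 P g) \<and>
    comp1 P g' = \<sigma> * (hs_z P w * comp2 P g - hs_y P w * g $ 3) \<and>
    comp2 P g' = \<sigma> * (d * hs_y P w * g $ 3 - hs_z P w * comp1 P g + A * g $ 3) \<and>
    g' $ 3 = \<sigma> * (- d * hs_y P w * comp2 P g + hs_y P w * comp1 P g - A * comp2 P g)"
proof -
  note m = manifold_components[OF assms]
  have G: "mass P * gravity P * hs_rho P = \<sigma> / \<mu>"
    using \<mu>_pos \<sigma>_\<mu>(2) by (simp add: hs_Gamma_def field_simps)
  let ?L = "inertia P w' + cross3 w (inertia P w + gyro_momentum P)"
  let ?R = "(mass P * gravity P) *\<^sub>R cross3 g (center_of_mass P)"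
  have "comp1 P ?L = comp1 P (inertia P w')" "comp1 P ?R = 0"
    unfolding vector_component_simps(1)[of _ "inertia P w'"] vector_component_simps(2)
      cross3_components m center_of_mass_components by simp_all
  then have e1: "comp1 P ?L = comp1 P ?R \<longleftrightarrow> comp1 P (inertia P w') = 0"
    by simp
  have "comp2 P ?R = (mass P * gravity P * hs_rho P) * g $ 3"
    unfolding vector_component_simps(4) cross3_components center_of_mass_components by simp
  then have R2: "comp2 P ?R = \<sigma> / \<mu> * g $ 3"
    by (simp add: G)
  have L2: "comp2 P ?L = comp2 P (inertia P w') + \<sigma> * hs_z P w * (B / \<mu>)
      - \<sigma> * (A + d * hs_y P w) * (hs_z P w / \<mu>)"
    unfolding vector_component_simps(3)[of _ "inertia P w'"] cross3_components m by simp
  have e2: "comp2 P ?L = comp2 P ?R \<longleftrightarrow> comp2 P (inertia P w') * \<mu>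
      = \<sigma> * (d * hs_y P w * hs_z P w + (A - B) * hs_z P w + g $ 3)"
    unfolding L2 R2 using \<mu>_pos by (simp add: divide_simps) (auto simp: algebra_simps)
  have "?R $ 3 = - (mass P * gravity P * hs_rho P) * comp2 P g"
    unfolding vector_scaleR_component cross3_components center_of_mass_components by simp
  then have R3: "?R $ 3 = - (\<sigma> / \<mu>) * comp2 P g"
    by (simp add: G)
  have L3: "?L $ 3 = inertia P w' $ 3 + \<sigma> * (A + d * hs_y P w) * (hs_y P w / \<mu>)
      - \<sigma> * hs_y P w * (B / \<mu>)"
    unfolding vector_add_component[of "inertia P w'"] cross3_components m by simp
  have e3: "?L $ 3 = ?R $ 3 \<longleftrightarrow> inertia P w' $ 3 * \<mu>
      = \<sigma> * (- d * (hs_y P w)\<^sup>2 - (A - B) * hs_y P w - comp2 P g)"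
    unfolding L3 R3 using \<mu>_pos
    by (simp add: divide_simps) (auto simp: algebra_simps power2_eq_square)
  show ?thesis
    unfolding eq_iff_components[of ?L] e1 e2 e3
    unfolding eq_iff_components[of g'] cross3_components m
    by (simp add: algebra_simps)
qed

lemma comp_has_real_derivative:
  assumes "(f has_vector_derivative f') (at t)"
  shows "((\<lambda>t. comp1 P (f t)) has_real_derivative comp1 P f') (at t)"
    "((\<lambda>t. comp2 P (f t)) has_real_derivative comp2 P f') (at t)"
    "((\<lambda>t. f t $ 3) has_real_derivative f' $ 3) (at t)"
  using assms rho_pos unfolding comp1_def comp2_def has_vector_derivative_vec3
  by (auto intro!: derivative_eq_intros)

lemma inertia_has_vector_derivative:
  assumes "(f has_vector_derivative f') (at t)"
  shows "((\<lambda>t. inertia P (f t)) has_vector_derivative inertia P f') (at t)"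
  using assms unfolding has_vector_derivative_vec3
  by (auto simp: inertia_def intro!: DERIV_cmult)

lemma motion_imp_reduced_system:
  assumes "hs_motion P T \<omega> \<gamma>"
  shows "reduced_system \<sigma> d A B T (\<lambda>t. hs_y P (\<omega> t)) (\<lambda>t. hs_z P (\<omega> t))
    (\<lambda>t. comp1 P (\<gamma> t)) (\<lambda>t. comp2 P (\<gamma> t)) (\<lambda>t. \<gamma> t $ 3)"
  unfolding reduced_system_def
proof
  fix t assume "t \<in> T"
  with assms obtain w' g' where
    w': "(\<omega> has_vector_derivative w') (at t)" and g': "(\<gamma> has_vector_derivative g') (at t)" and
    eq: "inertia P w' + cross3 (\<omega> t) (inertia P (\<omega> t) + gyro_momentum P)
      = (mass P * gravity P) *\<^sub>R cross3 (\<gamma> t) (center_of_mass P) \<and> g' = cross3 (\<gamma> t) (\<omega> t)" and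
    L1: "comp1 P (inertia P (\<omega> t)) = hs_c P * hs_k2 P / hs_b P"
    unfolding hs_motion_def euler_poisson_def by blast
  note D = comp_has_real_derivative[OF g']
    comp_has_real_derivative[OF inertia_has_vector_derivative[OF w']]
  have "((\<lambda>t. hs_y P (\<omega> t)) has_real_derivative comp2 P (inertia P w') * \<mu>) (at t)"
    "((\<lambda>t. hs_z P (\<omega> t)) has_real_derivative inertia P w' $ 3 * \<mu>) (at t)"
    unfolding hs_y_def hs_z_def \<mu>_def[symmetric] by (auto intro!: derivative_eq_intros D)
  with D(1-3) show "((\<lambda>t. hs_y P (\<omega> t)) has_real_derivative \<sigma> * (d * hs_y P (\<omega> t) * hs_z P (\<omega> t)
        + (A - B) * hs_z P (\<omega> t) + \<gamma> t $ 3)) (at t) \<and>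
      ((\<lambda>t. hs_z P (\<omega> t)) has_real_derivative \<sigma> * (- d * (hs_y P (\<omega> t))\<^sup>2
        - (A - B) * hs_y P (\<omega> t) - comp2 P (\<gamma> t))) (at t) \<and>
      ((\<lambda>t. comp1 P (\<gamma> t)) has_real_derivative \<sigma> * (hs_z P (\<omega> t) * comp2 P (\<gamma> t)
        - hs_y P (\<omega> t) * \<gamma> t $ 3)) (at t) \<and>
      ((\<lambda>t. comp2 P (\<gamma> t)) has_real_derivative \<sigma> * (d * hs_y P (\<omega> t) * \<gamma> t $ 3
        - hs_z P (\<omega> t) * comp1 P (\<gamma> t) + A * \<gamma> t $ 3)) (at t) \<and>
      ((\<lambda>t. \<gamma> t $ 3) has_real_derivative \<sigma> * (- d * hs_y P (\<omega> t) * comp2 P (\<gamma> t)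
        + hs_y P (\<omega> t) * comp1 P (\<gamma> t) - A * comp2 P (\<gamma> t))) (at t)"
    using eq[unfolded euler_poisson_components_iff[OF L1]] by metis
qed

section \<open>Building a motion from a solution of the reduced system\<close>

definition of_components :: "real \<Rightarrow> real \<Rightarrow> real \<Rightarrow> real^3" where
  "of_components p q r = vector [(p * center_of_mass P $ 1 - q * center_of_mass P $ 2) / hs_rho P,
     (p * center_of_mass P $ 2 + q * center_of_mass P $ 1) / hs_rho P, r]"

lemma of_components:
  "comp1 P (of_components p q r) = p" "comp2 P (of_components p q r) = q"
  "of_components p q r $ 3 = r"
proof -
  let ?x = "center_of_mass P $ 1" and ?y = "center_of_mass P $ 2" and ?r = "hs_rho P"
  have "comp1 P (of_components p q r) = p * (?x\<^sup>2 + ?y\<^sup>2) / ?r\<^sup>2"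
    "comp2 P (of_components p q r) = q * (?x\<^sup>2 + ?y\<^sup>2) / ?r\<^sup>2"
    using rho_pos by (simp_all add: comp1_def comp2_def of_components_def power2_eq_square
        add_divide_distrib[symmetric] diff_divide_distrib[symmetric]) (simp_all add: algebra_simps)
  then show "comp1 P (of_components p q r) = p" "comp2 P (of_components p q r) = q"
    unfolding rho_sq[symmetric] using rho_pos by simp_all
qed (simp add: of_components_def)

lemma of_components_has_vector_derivative:
  assumes "(p has_real_derivative p') (at t)" "(q has_real_derivative q') (at t)"
    "(r has_real_derivative r') (at t)"
  shows "((\<lambda>t. of_components (p t) (q t) (r t)) has_vector_derivative of_components p' q' r') (at t)"
  unfolding has_vector_derivative_vec3 of_components_def
  using rho_pos by (auto intro!: derivative_eq_intros assms)

definition inertia_inv :: "real^3 \<Rightarrow> real^3" where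
  "inertia_inv v = (\<chi> i. v $ i / moments P $ i)"

lemma inertia_inertia_inv: "inertia P (inertia_inv v) = v"
  using moments_pos by (simp add: inertia_def inertia_inv_def vec_eq_iff less_imp_neq[symmetric])

lemma inertia_inj: "inertia P v = inertia P w \<Longrightarrow> v = w"
  using moments_pos by (simp add: inertia_def vec_eq_iff) (metis less_irrefl)

lemma inertia_inv_has_vector_derivative:
  assumes "(f has_vector_derivative f') (at t)"
  shows "((\<lambda>t. inertia_inv (f t)) has_vector_derivative inertia_inv f') (at t)"
  using assms unfolding has_vector_derivative_vec3
  by (auto simp: inertia_inv_def intro!: DERIV_cdivide)

text \<open>Solves L1 = c k2 / b, L2 + k2 = y / \<mu> and L3 = z / \<mu> for the angular
  velocity.\<close>

definition angular_velocity :: "real \<Rightarrow> real \<Rightarrow> real^3" where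
  "angular_velocity y z =
     inertia_inv (of_components (hs_c P * hs_k2 P / hs_b P) (y / \<mu> - hs_k2 P) (z / \<mu>))"

lemma angular_velocity:
  "comp1 P (inertia P (angular_velocity y z)) = hs_c P * hs_k2 P / hs_b P"
  "hs_y P (angular_velocity y z) = y" "hs_z P (angular_velocity y z) = z"
  using \<mu>_pos by (simp_all add: angular_velocity_def inertia_inertia_inv of_components hs_y_def
      hs_z_def \<mu>_def[symmetric])

lemma angular_velocity_unique:
  assumes "comp1 P (inertia P w) = hs_c P * hs_k2 P / hs_b P"
  shows "w = angular_velocity (hs_y P w) (hs_z P w)"
proof (rule inertia_inj)
  show "inertia P w = inertia P (angular_velocity (hs_y P w) (hs_z P w))"
    using assms \<mu>_pos unfolding eq_iff_components
    by (simp add: angular_velocity_def inertia_inertia_inv of_components hs_y_def hs_z_def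
        \<mu>_def[symmetric])
qed

lemma reduced_system_imp_motion:
  assumes sys: "reduced_system \<sigma> d A B T y z n1 n2 n3"
    and unit: "\<And>t. t \<in> T \<Longrightarrow> (n1 t)\<^sup>2 + (n2 t)\<^sup>2 + (n3 t)\<^sup>2 = 1"
  shows "hs_motion P T (\<lambda>t. angular_velocity (y t) (z t)) (\<lambda>t. of_components (n1 t) (n2 t) (n3 t))"
    (is "hs_motion P T ?\<omega> ?\<gamma>")
proof -
  have "\<exists>\<omega>' \<gamma>'. (?\<omega> has_vector_derivative \<omega>') (at t) \<and> (?\<gamma> has_vector_derivative \<gamma>') (at t) \<and>
        inertia P \<omega>' + cross3 (?\<omega> t) (inertia P (?\<omega> t) + gyro_momentum P)
          = (mass P * gravity P) *\<^sub>R cross3 (?\<gamma> t) (center_of_mass P) \<and>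
        \<gamma>' = cross3 (?\<gamma> t) (?\<omega> t)" if "t \<in> T" for t
  proof -
    define y' z' n1' n2' n3' where
      eqs: "y' = \<sigma> * (d * y t * z t + (A - B) * z t + n3 t)"
        "z' = \<sigma> * (- d * (y t)\<^sup>2 - (A - B) * y t - n2 t)"
        "n1' = \<sigma> * (z t * n2 t - y t * n3 t)"
        "n2' = \<sigma> * (d * y t * n3 t - z t * n1 t + A * n3 t)"
        "n3' = \<sigma> * (- d * y t * n2 t + y t * n1 t - A * n2 t)"
    have D: "(y has_real_derivative y') (at t)" "(z has_real_derivative z') (at t)"
        "(n1 has_real_derivative n1') (at t)" "(n2 has_real_derivative n2') (at t)"
        "(n3 has_real_derivative n3') (at t)"
      using sys that unfolding reduced_system_def eqs by blast+
    \<comment> \<open>The first entry is 0 because L1 is constant on the manifold.\<close>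
    let ?w' = "inertia_inv (of_components 0 (y' / \<mu>) (z' / \<mu>))" and ?g' = "of_components n1' n2' n3'"
    have "(?\<omega> has_vector_derivative ?w') (at t)"
      unfolding angular_velocity_def using \<mu>_pos
      by (intro inertia_inv_has_vector_derivative of_components_has_vector_derivative)
        (auto intro!: derivative_eq_intros D)
    moreover have "(?\<gamma> has_vector_derivative ?g') (at t)"
      by (intro of_components_has_vector_derivative D)
    moreover have "inertia P ?w' + cross3 (?\<omega> t) (inertia P (?\<omega> t) + gyro_momentum P)
          = (mass P * gravity P) *\<^sub>R cross3 (?\<gamma> t) (center_of_mass P) \<and>
        ?g' = cross3 (?\<gamma> t) (?\<omega> t)"
      unfolding euler_poisson_components_iff[OF angular_velocity(1)]
      using \<mu>_pos by (simp add: inertia_inertia_inv of_components angular_velocity eqs)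
    ultimately show ?thesis
      by blast
  qed
  moreover have "norm (?\<gamma> t) = 1" if "t \<in> T" for t
    using norm_components[of "?\<gamma> t"] unit[OF that] norm_ge_zero[of "?\<gamma> t"]
    by (simp only: of_components) (auto simp: power2_eq_1_iff)
  ultimately show ?thesis
    by (auto simp: hs_motion_def euler_poisson_def angular_velocity)
qed

end

subsection \<open>First integrals and polar coordinates\<close>

context hess_sretensky_gyrostat
begin

text \<open>Regrouped by \<open>d * y t + A\<close>, which is the first component of the angular
  velocity in units of \<open>\<sigma>\<close>. The terms with this factor rotate (y, z) and (n2,
  n3), and they cancel in the integrals.\<close>

lemma reduced_systemD:
  assumes "reduced_system \<sigma> d A B T y z n1 n2 n3" "t \<in> T"
  shows "(y has_real_derivative \<sigma> * (z t * (d * y t + A - B) + n3 t)) (at t)"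
    "(z has_real_derivative \<sigma> * (- y t * (d * y t + A - B) - n2 t)) (at t)"
    "(n1 has_real_derivative \<sigma> * (z t * n2 t - y t * n3 t)) (at t)"
    "(n2 has_real_derivative \<sigma> * ((d * y t + A) * n3 t - z t * n1 t)) (at t)"
    "(n3 has_real_derivative \<sigma> * (y t * n1 t - (d * y t + A) * n2 t)) (at t)"
proof -
  have *: "d * y t * z t + (A - B) * z t + n3 t = z t * (d * y t + A - B) + n3 t"
    "- d * (y t)\<^sup>2 - (A - B) * y t - n2 t = - y t * (d * y t + A - B) - n2 t"
    "d * y t * n3 t - z t * n1 t + A * n3 t = (d * y t + A) * n3 t - z t * n1 t"
    "- d * y t * n2 t + y t * n1 t - A * n2 t = y t * n1 t - (d * y t + A) * n2 t"
    by (simp_all add: algebra_simps power2_eq_square)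
  show "(y has_real_derivative \<sigma> * (z t * (d * y t + A - B) + n3 t)) (at t)"
    "(z has_real_derivative \<sigma> * (- y t * (d * y t + A - B) - n2 t)) (at t)"
    "(n1 has_real_derivative \<sigma> * (z t * n2 t - y t * n3 t)) (at t)"
    "(n2 has_real_derivative \<sigma> * ((d * y t + A) * n3 t - z t * n1 t)) (at t)"
    "(n3 has_real_derivative \<sigma> * (y t * n1 t - (d * y t + A) * n2 t)) (at t)"
    using bspec[OF assms(1)[unfolded reduced_system_def] assms(2)] by (simp_all only: *)
qed

text \<open>Both derivatives vanish identically; connectedness of \<open>T\<close> turns this into
  one pair of constants, the parameters of all the polynomials below.\<close>

lemma first_integrals_exist:
  assumes sys: "reduced_system \<sigma> d A B T y z n1 n2 n3" and T: "is_interval T"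
  obtains h p1 where "\<And>t. t \<in> T \<Longrightarrow> ((y t)\<^sup>2 + (z t)\<^sup>2) / 2 + n1 t = h"
    "\<And>t. t \<in> T \<Longrightarrow> y t * n2 t + z t * n3 t + B * n1 t = p1"
proof -
  note D = reduced_systemD[OF sys]
  have "\<exists>h. \<forall>t\<in>T. ((y t)\<^sup>2 + (z t)\<^sup>2) / 2 + n1 t = h"
  proof (rule has_field_derivative_zero_constant)
    fix t assume t: "t \<in> T"
    show "((\<lambda>t. ((y t)\<^sup>2 + (z t)\<^sup>2) / 2 + n1 t) has_real_derivative 0) (at t within T)"
      by (rule has_field_derivative_at_within)
        (auto intro!: derivative_eq_intros D[OF t] simp: field_simps)
  qed (use T is_interval_convex in auto)
  moreover have "\<exists>p. \<forall>t\<in>T. y t * n2 t + z t * n3 t + B * n1 t = p"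
  proof (rule has_field_derivative_zero_constant)
    fix t assume t: "t \<in> T"
    show "((\<lambda>t. y t * n2 t + z t * n3 t + B * n1 t) has_real_derivative 0) (at t within T)"
      by (rule has_field_derivative_at_within)
        (auto intro!: derivative_eq_intros D[OF t] simp: algebra_simps)
  qed (use T is_interval_convex in auto)
  ultimately show ?thesis
    using that by blast
qed

end

text \<open>The scalar content of a motion with fixed integrals. It is used both for the whole time
  interval and for its subintervals of regular times.\<close>

locale reduced_motion = hess_sretensky_gyrostat +
  fixes T :: "real set" and y z n1 n2 n3 :: "real \<Rightarrow> real" and h p1 :: real
  assumes sys: "reduced_system \<sigma> d A B T y z n1 n2 n3"
    and unit: "t \<in> T \<Longrightarrow> (n1 t)\<^sup>2 + (n2 t)\<^sup>2 + (n3 t)\<^sup>2 = 1"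
    and energy: "t \<in> T \<Longrightarrow> ((y t)\<^sup>2 + (z t)\<^sup>2) / 2 + n1 t = h"
    and area: "t \<in> T \<Longrightarrow> y t * n2 t + z t * n3 t + B * n1 t = p1"
begin

abbreviation "P3 \<equiv> hs_P3 P h p1"
abbreviation "Q3 \<equiv> hs_Q3 P h p1"
abbreviation "P6 \<equiv> hs_P6 P h p1"

definition "x t = sqrt ((y t)\<^sup>2 + (z t)\<^sup>2)"
definition "m t = z t * n2 t - y t * n3 t"

lemmas derivs = reduced_systemD[OF sys]

lemma x_nonneg: "x t \<ge> 0"
  by (simp add: x_def)

lemma x_sq: "(x t)\<^sup>2 = (y t)\<^sup>2 + (z t)\<^sup>2"
  by (simp add: x_def)

lemma n1_eq: "t \<in> T \<Longrightarrow> n1 t = h - (x t)\<^sup>2 / 2"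
  using energy[of t] x_sq[of t] by simp

text \<open>Lagrange's identity for the plane vectors (n2, n3) and (y, z): their lengths and their
  scalar product are functions of n1 by the integrals, so the square of their determinant is a cubic
  in n1.\<close>

lemma m_sq_n1:
  assumes t: "t \<in> T"
  shows "(m t)\<^sup>2 = 2 * (1 - (n1 t)\<^sup>2) * (h - n1 t) - (p1 - B * n1 t)\<^sup>2"
proof -
  have "(m t)\<^sup>2 = ((n2 t)\<^sup>2 + (n3 t)\<^sup>2) * ((y t)\<^sup>2 + (z t)\<^sup>2) - (y t * n2 t + z t * n3 t)\<^sup>2"
    by (simp add: m_def power2_eq_square algebra_simps)
  moreover have "(n2 t)\<^sup>2 + (n3 t)\<^sup>2 = 1 - (n1 t)\<^sup>2" "(y t)\<^sup>2 + (z t)\<^sup>2 = 2 * (h - n1 t)"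
    "y t * n2 t + z t * n3 t = p1 - B * n1 t"
    using unit[OF t] area[OF t] energy[OF t] by auto
  ultimately show ?thesis by (simp only:)
qed

lemma m_sq: "t \<in> T \<Longrightarrow> 4 * (m t)\<^sup>2 = - P6 (x t)"
  by (simp only: m_sq_n1 n1_eq hs_P6_def) (simp add: field_simps eval_nat_numeral)

lemma n1_deriv: "t \<in> T \<Longrightarrow> (n1 has_real_derivative \<sigma> * m t) (at t)"
  using derivs(3) by (simp add: m_def)

text \<open>The right-hand side is \<sigma> times half the derivative of the cubic in
  \<open>m_sq_n1\<close>. Differentiating that identity would require division by m; the direct
  computation also covers the zeros of m, where \<open>n1_constant\<close> uses it.\<close>

lemma m_deriv:
  assumes t: "t \<in> T"
  shows "(m has_real_derivative
    \<sigma> * (B * (p1 - B * n1 t) - 2 * (h - n1 t) * n1 t - (1 - (n1 t)\<^sup>2))) (at t)"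
proof -
  define r where "r = y t * n2 t + z t * n3 t"
  have "(m has_real_derivative
      \<sigma> * (B * r - ((y t)\<^sup>2 + (z t)\<^sup>2) * n1 t - ((n2 t)\<^sup>2 + (n3 t)\<^sup>2))) (at t)"
    unfolding m_def[abs_def] r_def
    by (auto intro!: derivative_eq_intros derivs[OF t] simp: algebra_simps power2_eq_square)
  moreover have "r = p1 - B * n1 t" "(y t)\<^sup>2 + (z t)\<^sup>2 = 2 * (h - n1 t)"
    "(n2 t)\<^sup>2 + (n3 t)\<^sup>2 = 1 - (n1 t)\<^sup>2"
    using unit[OF t] area[OF t] energy[OF t] by (auto simp: r_def)
  ultimately show ?thesis by simp
qed

lemma x_deriv:
  assumes t: "t \<in> T" and "x t > 0"
  shows "(x has_real_derivative - (\<sigma> * m t / x t)) (at t)"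
proof -
  have "((\<lambda>t. (y t)\<^sup>2 + (z t)\<^sup>2) has_real_derivative - (2 * \<sigma> * m t)) (at t)"
    by (auto intro!: derivative_eq_intros derivs[OF t] simp: m_def algebra_simps)
  moreover have "(y t)\<^sup>2 + (z t)\<^sup>2 > 0"
    using assms by (simp add: x_def)
  ultimately have "((\<lambda>t. sqrt ((y t)\<^sup>2 + (z t)\<^sup>2)) has_real_derivative
      inverse (sqrt ((y t)\<^sup>2 + (z t)\<^sup>2)) / 2 * (- (2 * \<sigma> * m t))) (at t)"
    by (intro DERIV_chain2[OF DERIV_real_sqrt])
  then show ?thesis
    by (simp add: x_def[abs_def] field_simps)
qed

text \<open>The quotient \<open>z / (x + y)\<close> is the tangent of half the polar angle of \<open>(y, z)\<close>.\<close>

lemma tan_half_deriv: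
  assumes t: "t \<in> T" and x: "x t > 0" and y: "y t \<noteq> - x t"
  shows "((\<lambda>t. z t / (x t + y t)) has_real_derivative
    \<sigma> * (P3 (x t) * (z t / (x t + y t))\<^sup>2 - Q3 (x t)) / (4 * (x t)\<^sup>2)) (at t)"
proof -
  define k where "k = d * y t + A - B"
  define X Y Z where "X = x t" and "Y = y t" and "Z = z t"
  have nz: "X + Y \<noteq> 0" "X \<noteq> 0"
    using x y by (auto simp: X_def Y_def)
  define x' y' z' where "x' = - (\<sigma> * m t / x t)"
    and "y' = \<sigma> * (z t * k + n3 t)" and "z' = \<sigma> * (- y t * k - n2 t)"
  have deriv: "((\<lambda>t. z t / (x t + y t)) has_real_derivative
      (z' * (X + Y) - Z * (x' + y')) / (X + Y)\<^sup>2) (at t)"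
    using nz unfolding X_def Y_def Z_def x'_def y'_def z'_def k_def
    by (auto intro!: derivative_eq_intros derivs[OF t] x_deriv[OF t x] simp: power2_eq_square)
  have sq: "X\<^sup>2 = Y\<^sup>2 + Z\<^sup>2"
    using x_sq[of t] by (simp add: X_def Y_def Z_def)
  have "X * x' = Y * y' + Z * z'"
  proof -
    have "X * x' = - \<sigma> * m t"
      using nz by (simp add: x'_def X_def)
    then show ?thesis
      by (simp add: y'_def z'_def m_def Y_def Z_def algebra_simps)
  qed
  \<comment> \<open>The half-angle rule w' = (1 + w^2) \<phi>' / 2 cleared of denominators, with
    \<phi>' = (Y z' - Z y') / X^2 and 1 + w^2 = 2 X / (X + Y).\<close>
  then have "X * (z' * (X + Y) - Z * (x' + y')) = (X + Y) * (Y * z' - Z * y')"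
    using sq by algebra
  moreover have "Y * z' - Z * y' = - \<sigma> * (k * X\<^sup>2 + (y t * n2 t + z t * n3 t))"
    unfolding sq by (simp add: y'_def z'_def Y_def Z_def algebra_simps power2_eq_square)
  moreover have "y t * n2 t + z t * n3 t = p1 - B * h + B * X\<^sup>2 / 2"
    using area[OF t] n1_eq[OF t] by (simp add: X_def algebra_simps)
  ultimately have num: "X * (z' * (X + Y) - Z * (x' + y'))
      = - \<sigma> * (X + Y) * (k * X\<^sup>2 + p1 - B * h + B * X\<^sup>2 / 2)"
    by simp
  \<comment> \<open>Here \<open>P3\<close> and \<open>Q3\<close> originate: Y still occurs in k, and
    Y = X (1 - w^2) / (1 + w^2) turns the angular speed times 1 + w^2 into a polynomial in w^2 with
    these coefficients.\<close>
  have "P3 X * Z\<^sup>2 - Q3 X * (X + Y)\<^sup>2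
      = - 4 * X * (X + Y) * (k * X\<^sup>2 + p1 - B * h + B * X\<^sup>2 / 2)"
    using sq unfolding hs_Q3_def hs_P3_def k_def Y_def[symmetric] by algebra
  moreover have "P3 X * (Z / (X + Y))\<^sup>2 - Q3 X = (P3 X * Z\<^sup>2 - Q3 X * (X + Y)\<^sup>2) / (X + Y)\<^sup>2"
    using nz by (simp add: power_divide diff_divide_distrib)
  ultimately have "P3 X * (Z / (X + Y))\<^sup>2 - Q3 X
      = - 4 * X * (X + Y) * (k * X\<^sup>2 + p1 - B * h + B * X\<^sup>2 / 2) / (X + Y)\<^sup>2"
    by simp
  then have "\<sigma> * (P3 X * (Z / (X + Y))\<^sup>2 - Q3 X) / (4 * X\<^sup>2)
      = - \<sigma> * (X + Y) * (k * X\<^sup>2 + p1 - B * h + B * X\<^sup>2 / 2) / (X * (X + Y)\<^sup>2)"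
    using nz by (simp only:) (simp add: power2_eq_square)
  also have "\<dots> = (z' * (X + Y) - Z * (x' + y')) / (X + Y)\<^sup>2"
    using nz unfolding num[symmetric] by simp
  finally show ?thesis
    using deriv unfolding X_def Y_def Z_def by simp
qed

text \<open>At polar angle \<pi> the area integral loses its n3 term and determines n2. Where
  \<open>P3\<close> does not vanish, z therefore crosses zero transversally and the angle cannot
  stay at \<pi>.\<close>

lemma z_deriv_at_pi:
  assumes t: "t \<in> T" and x: "x t > 0" and y: "y t = - x t"
  shows "(z has_real_derivative - (\<sigma> * P3 (x t) / (2 * x t))) (at t)"
proof -
  have "z t = 0"
    using x_sq[of t] y by simp
  then have "n2 t * x t = B * (h - (x t)\<^sup>2 / 2) - p1"
    using area[OF t] y n1_eq[OF t] by (simp add: algebra_simps)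
  then have n2: "n2 t = (B * (h - (x t)\<^sup>2 / 2) - p1) / x t"
    using x by (simp add: field_simps)
  have "- y t * (d * y t + A - B) - n2 t = - (P3 (x t) / (2 * x t))"
    unfolding n2 y hs_P3_def using x by (simp add: field_simps power2_eq_square power3_eq_cube)
  then show ?thesis
    using derivs(2)[OF t] by simp
qed

end

subsection \<open>Density of the regular times\<close>

text \<open>Gronwall's inequality in both time directions: \<open>f t * exp (- L * t)\<close> is
  nonincreasing and \<open>f t * exp (L * t)\<close> is nondecreasing, so the zero at
  \<open>t0\<close> spreads to either side.\<close>

lemma zero_of_abs_deriv_le:
  fixes f f' :: "real \<Rightarrow> real"
  assumes T: "is_interval T" and t0: "t0 \<in> T" "f t0 = 0" and nonneg: "\<And>t. t \<in> T \<Longrightarrow> f t \<ge> 0"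
    and deriv: "\<And>t. t \<in> T \<Longrightarrow> (f has_real_derivative f' t) (at t)"
    and bound: "\<And>t. t \<in> T \<Longrightarrow> \<bar>f' t\<bar> \<le> L * f t" and t: "t \<in> T"
  shows "f t = 0"
proof (cases "t0 \<le> t")
  case True
  have "f t * exp (- L * t) \<le> f t0 * exp (- L * t0)"
  proof (rule DERIV_nonpos_imp_nonincreasing[OF True])
    fix s assume "t0 \<le> s" "s \<le> t"
    then have s: "s \<in> T"
      using mem_is_interval_1_I[OF T t0(1) t] by blast
    have "((\<lambda>s. f s * exp (- L * s)) has_real_derivative (f' s - L * f s) * exp (- L * s)) (at s)"
      by (rule derivative_eq_intros deriv[OF s] refl | simp add: algebra_simps)+
    moreover have "(f' s - L * f s) * exp (- L * s) \<le> 0"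
      using bound[OF s] by (intro mult_nonpos_nonneg) auto
    ultimately show "\<exists>y. ((\<lambda>s. f s * exp (- L * s)) has_real_derivative y) (at s) \<and> y \<le> 0"
      by blast
  qed
  then show ?thesis
    using t0 nonneg[OF t] by (simp add: mult_le_0_iff)
next
  case False
  then have le: "t \<le> t0" by simp
  have "f t * exp (L * t) \<le> f t0 * exp (L * t0)"
  proof (rule DERIV_nonneg_imp_nondecreasing[OF le])
    fix s assume "t \<le> s" "s \<le> t0"
    then have s: "s \<in> T"
      using mem_is_interval_1_I[OF T t t0(1)] by blast
    have "((\<lambda>s. f s * exp (L * s)) has_real_derivative (f' s + L * f s) * exp (L * s)) (at s)"
      by (rule derivative_eq_intros deriv[OF s] refl | simp add: algebra_simps)+
    moreover have "(f' s + L * f s) * exp (L * s) \<ge> 0"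
      using bound[OF s] by (intro mult_nonneg_nonneg) auto
    ultimately show "\<exists>y. ((\<lambda>s. f s * exp (L * s)) has_real_derivative y) (at s) \<and> y \<ge> 0"
      by blast
  qed
  then show ?thesis
    using t0 nonneg[OF t] by (simp add: mult_le_0_iff)
qed

context hess_sretensky_gyrostat
begin

text \<open>The leading coefficient is 2 d1, nonzero by assumption.\<close>

lemma finite_P3_roots: "finite {x. hs_P3 P h p1 x = 0}"
proof -
  let ?p = "[:2 * (B * h - p1), 0, B - 2 * A, 2 * d:]"
  have "hs_P3 P h p1 x = poly ?p x" for x
    by (simp add: hs_P3_def algebra_simps power2_eq_square power3_eq_cube)
  moreover have "?p \<noteq> 0"
    using d1_nonzero by simp
  ultimately show ?thesis
    using poly_roots_finite[of ?p] by simp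
qed

lemma finite_P6_roots: "finite {x. hs_P6 P h p1 x = 0}"
proof -
  let ?p = "[:4 * (B * h - p1)\<^sup>2, 0, 4 * (h\<^sup>2 - 1 - B * (B * h - p1)), 0, B\<^sup>2 - 4 * h, 0, 1:]"
  have "hs_P6 P h p1 x = poly ?p x" for x
    by (simp add: hs_P6_def algebra_simps eval_nat_numeral)
  moreover have "?p \<noteq> 0"
    by simp
  ultimately show ?thesis
    using poly_roots_finite[of ?p] by simp
qed

lemma open_regular_x: "open (hs_regular_x P h p1)"
  unfolding hs_regular_x_def hs_P3_def hs_P6_def
  by (intro open_Collect_conj open_Collect_less open_Collect_neq continuous_intros)

end

context reduced_motion
begin

lemma continuous_coordinates:
  "continuous_on T y" "continuous_on T z" "continuous_on T n1" "continuous_on T m" "continuous_on T x"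
proof -
  show y: "continuous_on T y" and z: "continuous_on T z" and "continuous_on T n1"
    and "continuous_on T m"
    using derivs(1,2,3) m_deriv
    by (meson DERIV_isCont continuous_at_imp_continuous_on)+
  show "continuous_on T x"
    unfolding x_def[abs_def] by (intro continuous_intros y z)
qed

text \<open>If \<open>n1\<close> is stationary on an interval then its value \<open>n0\<close> is a double root of the cubic
  \<open>m\<^sup>2\<close>, so \<open>\<bar>n1'\<bar>\<close> is bounded by a multiple of \<open>\<bar>n1 - n0\<bar>\<close>.\<close>

lemma n1_constant:
  assumes T: "open T" "is_interval T" and S: "open S" "S \<subseteq> T" "t0 \<in> S"
    and const: "\<And>t. t \<in> S \<Longrightarrow> n1 t = n0" and t: "t \<in> T"
  shows "n1 t = n0"
proof -
  have m0: "m s = 0" if s: "s \<in> S" for s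
  proof -
    have "(n1 has_real_derivative 0) (at s)"
      by (rule has_field_derivative_transform_within_open[of "\<lambda>_. n0" _ _ S])
        (use S s const in auto)
    then show ?thesis
      using DERIV_unique[OF n1_deriv] S s \<sigma>_pos by fastforce
  qed
  have "(m has_real_derivative 0) (at t0)"
    by (rule has_field_derivative_transform_within_open[of "\<lambda>_. 0" _ _ S])
      (use S m0 in auto)
  then have m': "B * (p1 - B * n0) - 2 * (h - n0) * n0 - (1 - n0\<^sup>2) = 0"
    using DERIV_unique[OF m_deriv[of t0]] S \<sigma>_pos const[of t0] by fastforce
  have m2: "2 * (1 - n0\<^sup>2) * (h - n0) - (p1 - B * n0)\<^sup>2 = 0"
    using m_sq_n1[of t0] m0[of t0] const[of t0] S by auto
  have n1_bound: "\<bar>n1 s\<bar> \<le> 1" if "s \<in> T" for s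
  proof -
    have "(n1 s)\<^sup>2 \<le> 1\<^sup>2"
      using unit[OF that] by (smt (verit) one_power2 zero_le_power2)
    then show ?thesis
      by (simp add: abs_square_le_1)
  qed
  \<comment> \<open>Bounds the linear cofactor below: 2 from n1 and 4 from n0, both of modulus at
    most 1, and the term with h; the term \<open>- B\<^sup>2\<close> only helps.\<close>
  define C where "C = 6 + 2 * \<bar>h\<bar>"
  have m_bound: "(m s)\<^sup>2 \<le> C * (n1 s - n0)\<^sup>2" if s: "s \<in> T" for s
  proof -
    \<comment> \<open>The cubic has leading coefficient 2 and double root n0; the sum of its roots
      gives h + B^2 / 2 - 2 n0 as the third root.\<close>
    have "(m s)\<^sup>2 = (2 * n1 s + 4 * n0 - 2 * h - B\<^sup>2) * (n1 s - n0)\<^sup>2"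
      unfolding m_sq_n1[OF s] using m' m2 by algebra
    moreover have "2 * n1 s + 4 * n0 - 2 * h - B\<^sup>2 \<le> C"
      using n1_bound[OF s] n1_bound[of t0] const[of t0] S unfolding C_def
      by (smt (verit) subsetD zero_le_power2)
    ultimately show ?thesis
      by (simp add: mult_right_mono)
  qed
  \<comment> \<open>The square is differentiable, and \<open>2 * a * b \<le> a^2 + b^2\<close> fits
    the bound on the square of m.\<close>
  have "(n1 t - n0)\<^sup>2 = 0"
  proof (rule zero_of_abs_deriv_le[OF T(2), where ?t0.0 = t0
        and f = "\<lambda>s. (n1 s - n0)\<^sup>2" and f' = "\<lambda>s. \<sigma> * (2 * (n1 s - n0) * m s)"])
    fix s assume s: "s \<in> T"
    show "((\<lambda>s. (n1 s - n0)\<^sup>2) has_real_derivative \<sigma> * (2 * (n1 s - n0) * m s)) (at s)"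
      by (auto intro!: derivative_eq_intros n1_deriv[OF s])
    have "\<bar>2 * (n1 s - n0) * m s\<bar> \<le> (n1 s - n0)\<^sup>2 + (m s)\<^sup>2"
      using sum_squares_bound[of "\<bar>n1 s - n0\<bar>" "\<bar>m s\<bar>"]
      by (simp only: abs_mult power2_abs abs_numeral)
    also have "\<dots> \<le> (1 + C) * (n1 s - n0)\<^sup>2"
      using m_bound[OF s] by (simp add: algebra_simps)
    finally show "\<bar>\<sigma> * (2 * (n1 s - n0) * m s)\<bar> \<le> \<sigma> * (1 + C) * (n1 s - n0)\<^sup>2"
      using \<sigma>_pos by (simp add: abs_mult mult.assoc)
  qed (use S const t in auto)
  then show ?thesis by simp
qed

definition "regular_times = {t\<in>T. x t \<in> hs_regular_x P h p1 \<and> y t \<noteq> - x t}"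

lemma open_regular_times:
  assumes "open T"
  shows "open regular_times"
proof -
  have "regular_times = (T \<inter> x -` hs_regular_x P h p1) \<inter> (T \<inter> (\<lambda>t. y t + x t) -` (- {0}))"
    by (auto simp: regular_times_def)
  moreover have "open (T \<inter> x -` hs_regular_x P h p1)"
    by (rule continuous_open_preimage[OF continuous_coordinates(5) assms open_regular_x])
  moreover have "open (T \<inter> (\<lambda>t. y t + x t) -` (- {0}))"
    by (rule continuous_open_preimage[OF _ assms]) (auto intro!: continuous_intros continuous_coordinates)
  ultimately show ?thesis
    by (metis open_Int)
qed

text \<open>A nonconstant continuous image of an interval is infinite, so x avoids the finitely many
  roots of \<open>P3\<close> and \<open>P6\<close> and the value 0 somewhere in S. There
  \<open>P6 \<le> 0\<close>, which holds along every motion, becomes strict.\<close>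

lemma regular_times_meet_open:
  assumes T: "open T" "is_interval T" and x: "\<not> x constant_on T"
    and S: "open S" "is_interval S" "S \<noteq> {}" "S \<subseteq> T"
  shows "S \<inter> regular_times \<noteq> {}"
proof -
  obtain s0 where s0: "s0 \<in> S" using S by auto
  have "\<not> (\<exists>a. x ` S = {a})"
  proof
    assume "\<exists>a. x ` S = {a}"
    then obtain a where "\<And>t. t \<in> S \<Longrightarrow> x t = a" by auto
    then have "n1 t = h - a\<^sup>2 / 2" if "t \<in> S" for t
      using n1_eq[of t] that S by auto
    then have "n1 t = h - a\<^sup>2 / 2" if "t \<in> T" for t
      by (intro n1_constant[OF T S(1,4) s0 _ that])
    then have "x t = \<bar>a\<bar>" if "t \<in> T" for t
      using n1_eq[OF that] x_nonneg[of t] that by (simp add: power2_eq_iff) linarith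
    then show False
      using x by (auto simp: constant_on_def)
  qed
  moreover have "connected (x ` S)"
    using S by (intro connected_continuous_image continuous_on_subset[OF continuous_coordinates(5)])
      (auto simp: is_interval_connected)
  ultimately have inf: "infinite (x ` S)"
    using connected_finite_iff_sing s0 by blast
  have "finite ({r. P3 r = 0} \<union> {r. P6 r = 0} \<union> {0})"
    using finite_P3_roots finite_P6_roots by simp
  with inf have "\<not> x ` S \<subseteq> {r. P3 r = 0} \<union> {r. P6 r = 0} \<union> {0}"
    using finite_subset by blast
  then obtain t1 where t1: "t1 \<in> S" "P3 (x t1) \<noteq> 0" "P6 (x t1) \<noteq> 0" "x t1 \<noteq> 0"
    by auto
  have "P6 (x t1) \<le> 0"
    using m_sq[of t1] t1(1) S(4) zero_le_power2[of "m t1"] by (smt (verit) subsetD)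
  then have reg: "x t1 \<in> hs_regular_x P h p1"
    using t1 x_nonneg[of t1] by (auto simp: hs_regular_x_def)
  \<comment> \<open>The radius remains regular on this open set, so z = 0 throughout it could be
    differentiated at \<open>t1\<close>, against \<open>P3 (x t1) \<noteq> 0\<close>.\<close>
  define S' where "S' = S \<inter> x -` hs_regular_x P h p1"
  have S': "open S'" "t1 \<in> S'"
    unfolding S'_def using t1 reg S
    by (auto intro: continuous_open_preimage continuous_on_subset[OF continuous_coordinates(5)] open_regular_x)
  have "\<exists>t\<in>S'. y t \<noteq> - x t"
  proof (rule ccontr)
    assume "\<not> ?thesis"
    then have yx: "y t = - x t" if "t \<in> S'" for t
      using that by blast
    then have z0: "z t = 0" if "t \<in> S'" for t
      using x_sq[of t] that by simp
    have "(z has_real_derivative 0) (at t1)"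
      by (rule has_field_derivative_transform_within_open[of "\<lambda>_. 0" _ _ S'])
        (use S' z0 in auto)
    moreover have "(z has_real_derivative - (\<sigma> * P3 (x t1) / (2 * x t1))) (at t1)"
      using z_deriv_at_pi[of t1] yx[OF S'(2)] t1 S x_nonneg[of t1] by auto
    ultimately show False
      using DERIV_unique \<sigma>_pos t1 by fastforce
  qed
  then show ?thesis
    using S unfolding S'_def regular_times_def by auto
qed

lemma regular_times_dense:
  assumes T: "open T" "is_interval T" and x: "\<not> x constant_on T"
  shows "T \<subseteq> closure regular_times"
proof
  fix t assume t: "t \<in> T"
  show "t \<in> closure regular_times"
    unfolding closure_approachable
  proof (intro allI impI)
    fix e :: real assume "e > 0"
    then have "t \<in> ball t e \<inter> T"
      using t by simp
    then have "ball t e \<inter> T \<noteq> {}"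
      by blast
    then have "ball t e \<inter> T \<inter> regular_times \<noteq> {}"
      using T by (intro regular_times_meet_open[OF assms]) (auto intro: is_interval_Int is_interval_ball_real)
    then show "\<exists>s\<in>regular_times. dist s t < e"
      by (auto simp: dist_commute)
  qed
qed

end

subsection \<open>The Riccati equation and the linear equation\<close>

lemma cos_double_arctan: "cos (2 * arctan w) = (1 - w\<^sup>2) / (1 + w\<^sup>2)"
  and sin_double_arctan: "sin (2 * arctan w) = 2 * w / (1 + w\<^sup>2)"
proof -
  have "1 + w\<^sup>2 > 0"
    by (rule add_pos_nonneg) auto
  then show "cos (2 * arctan w) = (1 - w\<^sup>2) / (1 + w\<^sup>2)"
    "sin (2 * arctan w) = 2 * w / (1 + w\<^sup>2)"
    unfolding cos_double sin_double cos_arctan sin_arctan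
    by (simp_all add: power_divide diff_divide_distrib)
qed

text \<open>The endpoints of X may be infinite, so X is described as the extended-real interval
  between its infimum and supremum.\<close>

lemma primitive_on_open_interval:
  fixes f :: "real \<Rightarrow> real"
  assumes X: "open X" "is_interval X" and f: "continuous_on X f"
  shows "\<exists>U. \<forall>x\<in>X. (U has_real_derivative f x) (at x)"
proof (cases "X = {}")
  case False
  then obtain c where c: "c \<in> X" by blast
  have iff: "x \<in> X \<longleftrightarrow> Inf (ereal ` X) < ereal x \<and> ereal x < Sup (ereal ` X)" for x
  proof
    assume "x \<in> X"
    then obtain e where e: "e > 0" "cball x e \<subseteq> X"
      using X open_contains_cball by blast
    then have "x - e \<in> X" "x + e \<in> X"
      by (auto simp: subset_iff dist_real_def)
    then have "Inf (ereal ` X) \<le> ereal (x - e)" "ereal (x + e) \<le> Sup (ereal ` X)"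
      by (auto intro: Inf_lower Sup_upper)
    moreover have "ereal (x - e) < ereal x" "ereal x < ereal (x + e)"
      using e by auto
    ultimately show "Inf (ereal ` X) < ereal x \<and> ereal x < Sup (ereal ` X)"
      by (meson le_less_trans less_le_trans)
  next
    assume "Inf (ereal ` X) < ereal x \<and> ereal x < Sup (ereal ` X)"
    then obtain a b where "a \<in> X" "a < x" "b \<in> X" "x < b"
      by (auto simp: Inf_less_iff less_Sup_iff)
    then show "x \<in> X"
      using mem_is_interval_1_I[OF X(2), of a b x] by simp
  qed
  have "\<exists>U. \<forall>x. Inf (ereal ` X) < ereal x \<longrightarrow> ereal x < Sup (ereal ` X) \<longrightarrow>
      (U has_vector_derivative f x) (at x)"
  proof (rule einterval_antiderivative)
    show "Inf (ereal ` X) < Sup (ereal ` X)"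
      using c unfolding iff by (blast intro: less_trans)
    show "isCont f x" if "Inf (ereal ` X) < ereal x" "ereal x < Sup (ereal ` X)" for x
    proof -
      have "x \<in> X"
        unfolding iff using that by blast
      then show ?thesis
        using f X(1) continuous_on_eq_continuous_at by blast
    qed
  qed
  then show ?thesis
    unfolding has_real_derivative_iff_has_vector_derivative using iff by metis
qed simp

context hess_sretensky_gyrostat
begin

context
  fixes h p1 \<epsilon> :: real
  assumes \<epsilon>: "\<epsilon> \<in> {1, -1}"
begin

abbreviation "f2 \<equiv> hs_f2 P h p1 \<epsilon>"
abbreviation "f0 \<equiv> hs_f0 P h p1 \<epsilon>"
abbreviation "ca \<equiv> hs_coeff_a P h p1"
abbreviation "cb \<equiv> hs_coeff_b P h p1"
abbreviation "branch \<equiv> \<lambda>x. \<epsilon> * sqrt (- hs_P6 P h p1 x)"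

lemma \<epsilon>_sq: "\<epsilon>\<^sup>2 = 1" and \<epsilon>_nonzero: "\<epsilon> \<noteq> 0"
  using \<epsilon> by auto

lemma branch_deriv:
  assumes "x \<in> hs_regular_x P h p1"
  shows "(branch has_real_derivative - (3 * x^5 + 2 * (B\<^sup>2 - 4 * h) * x^3
      + 4 * (h\<^sup>2 - 1 - B * (B * h - p1)) * x) / branch x) (at x)" (is "(_ has_real_derivative - ?q / _) _")
proof -
  have neg: "- hs_P6 P h p1 x > 0"
    using assms by (simp add: hs_regular_x_def)
  have "((\<lambda>x. - hs_P6 P h p1 x) has_real_derivative - (2 * ?q)) (at x)"
    unfolding hs_P6_def
    by (auto intro!: derivative_eq_intros simp: algebra_simps)
  then have "((\<lambda>x. sqrt (- hs_P6 P h p1 x)) has_real_derivative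
      inverse (sqrt (- hs_P6 P h p1 x)) / 2 * (- (2 * ?q))) (at x)"
    by (rule DERIV_chain2[where f = sqrt and g = "\<lambda>x. - hs_P6 P h p1 x",
        OF DERIV_real_sqrt[OF neg]])
  then have "(branch has_real_derivative
      \<epsilon> * (inverse (sqrt (- hs_P6 P h p1 x)) / 2 * (- (2 * ?q)))) (at x)"
    by (rule DERIV_cmult)
  moreover have "\<epsilon> * (inverse s / 2 * (- (2 * q))) = - q / (\<epsilon> * s)" for q s :: real
    using \<epsilon> by (auto simp: inverse_eq_divide)
  ultimately show ?thesis
    by metis
qed

lemma branch_sq: "x \<in> hs_regular_x P h p1 \<Longrightarrow> (branch x)\<^sup>2 = - hs_P6 P h p1 x"
  by (simp add: power_mult_distrib \<epsilon>_sq hs_regular_x_def)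

lemma branch_nonzero: "x \<in> hs_regular_x P h p1 \<Longrightarrow> branch x \<noteq> 0"
  using \<epsilon>_nonzero by (auto simp: hs_regular_x_def)

lemma f2_nonzero: "x \<in> hs_regular_x P h p1 \<Longrightarrow> f2 x \<noteq> 0"
  using branch_nonzero[of x] by (auto simp: hs_f2_def hs_regular_x_def)

text \<open>Logarithmic differentiation: - f2' / f2 = 1 / x + P6' / (2 P6) - P3' / P3 is rational
  although \<open>f2\<close> contains a root. Over the denominator x P6 P3 its numerator is
  \<open>hs_P9\<close>.\<close>

lemma f2_deriv:
  assumes x: "x \<in> hs_regular_x P h p1"
  shows "(f2 has_real_derivative - ca x * f2 x) (at x)"
proof -
  define p p' q S where "p = hs_P3 P h p1 x" and "p' = 6 * d * x\<^sup>2 + 2 * (B - 2 * A) * x"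
    and "q = 3 * x^5 + 2 * (B\<^sup>2 - 4 * h) * x^3 + 4 * (h\<^sup>2 - 1 - B * (B * h - p1)) * x"
    and "S = branch x"
  have nz: "x \<noteq> 0" "p \<noteq> 0" "S \<noteq> 0"
    using x branch_nonzero[OF x] by (auto simp: hs_regular_x_def p_def S_def)
  have S2: "hs_P6 P h p1 x = - S\<^sup>2"
    using branch_sq[OF x] by (simp add: S_def)
  have p': "(hs_P3 P h p1 has_real_derivative p') (at x)"
    unfolding hs_P3_def[abs_def] p'_def
    by (auto intro!: derivative_eq_intros simp: algebra_simps)
  have "(f2 has_real_derivative
      (- p' * (2 * x * S) + p * (2 * S + 2 * x * (- q / S))) / (2 * x * S)\<^sup>2) (at x)"
  proof -
    define r where "r = branch"
    have r: "(r has_real_derivative - q / S) (at x)" "r x = S"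
      using branch_deriv[OF x, folded q_def S_def] by (simp_all add: r_def S_def)
    have "((\<lambda>x. - hs_P3 P h p1 x / (2 * x * r x)) has_real_derivative
        (- p' * (2 * x * S) + p * (2 * S + 2 * x * (- q / S))) / (2 * x * S)\<^sup>2) (at x)"
      using nz r by (auto intro!: derivative_eq_intros p' r simp: p_def[symmetric] power2_eq_square)
        (simp add: field_simps)
    then show ?thesis
      by (simp add: hs_f2_def[abs_def] r_def)
  qed
  \<comment> \<open>With \<open>S\<^sup>2 = - P6\<close> and q half the derivative of P6, this is P9
    = P3 P6 + x P3 P6' / 2 - x P3' P6, a polynomial identity.\<close>
  moreover have "hs_P9 P h p1 x = - p * S\<^sup>2 + x * q * p + x * p' * S\<^sup>2"
    unfolding S2[THEN arg_cong[of _ _ uminus], simplified, symmetric]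
    unfolding p_def q_def p'_def hs_P3_def hs_P6_def hs_P9_def Let_def
    by (simp add: algebra_simps eval_nat_numeral)
  then have "(- p' * (2 * x * S) + p * (2 * S + 2 * x * (- q / S))) / (2 * x * S)\<^sup>2 = - ca x * f2 x"
  proof -
    assume P9: "hs_P9 P h p1 x = - p * S\<^sup>2 + x * q * p + x * p' * S\<^sup>2"
    have "f2 x = - p / (2 * x * S)"
      by (simp add: hs_f2_def p_def S_def)
    moreover have "ca x = (- p * S\<^sup>2 + x * q * p + x * p' * S\<^sup>2) / (x * (- S\<^sup>2) * p)"
      by (simp only: hs_coeff_a_def P9 S2 p_def)
    ultimately show ?thesis
      using nz by (simp only:) (simp add: field_simps power2_eq_square)
  qed
  ultimately show ?thesis by simp
qed

lemma f2_f0: "x \<in> hs_regular_x P h p1 \<Longrightarrow> f2 x * f0 x = cb x"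
proof -
  assume x: "x \<in> hs_regular_x P h p1"
  have "f2 x * f0 x = - hs_P3 P h p1 x * hs_Q3 P h p1 x / (4 * x\<^sup>2 * (branch x)\<^sup>2)"
    unfolding hs_f2_def hs_f0_def by (simp add: power2_eq_square)
  then show ?thesis
    unfolding branch_sq[OF x] hs_coeff_b_def by simp
qed

lemma continuous_on_f2: "X \<subseteq> hs_regular_x P h p1 \<Longrightarrow> continuous_on X f2"
  by (meson DERIV_isCont continuous_at_imp_continuous_on f2_deriv subsetD)

text \<open>Substituting \<open>u' = - f2 w u\<close> into \<open>u''\<close> cancels the quadratic term of the Riccati
  equation.\<close>

lemma riccati_imp_linear:
  assumes X: "open X" "X \<subseteq> hs_regular_x P h p1"
    and w: "\<And>x. x \<in> X \<Longrightarrow> (w has_real_derivative f2 x * (w x)\<^sup>2 + f0 x) (at x)"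
    and U: "\<And>x. x \<in> X \<Longrightarrow> (U has_real_derivative f2 x * w x) (at x)"
  shows "solves_linear_ode2 X ca cb (\<lambda>x. exp (- U x))"
    and "\<And>x. x \<in> X \<Longrightarrow> w x = hs_w_of_u P h p1 \<epsilon> (\<lambda>x. exp (- U x)) x"
proof -
  define u where "u x = exp (- U x)" for x
  have u': "(u has_real_derivative - (f2 x * w x * u x)) (at x)" if "x \<in> X" for x
    unfolding u_def[abs_def] by (auto intro!: derivative_eq_intros U[OF that])
  then have du: "deriv u x = - (f2 x * w x * u x)" if "x \<in> X" for x
    using that by (simp add: DERIV_imp_deriv)
  \<comment> \<open>The formula for u' holds only on X; openness of X allows it to be differentiated
    there.\<close>
  have ddu: "(deriv u has_real_derivative ca x * (f2 x * w x * u x) - cb x * u x) (at x)"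
    if x: "x \<in> X" for x
  proof (rule has_field_derivative_transform_within_open[of "\<lambda>x. - (f2 x * w x * u x)" _ _ X])
    have x': "x \<in> hs_regular_x P h p1"
      using x X by blast
    show "((\<lambda>x. - (f2 x * w x * u x)) has_real_derivative
        ca x * (f2 x * w x * u x) - cb x * u x) (at x)"
      unfolding f2_f0[OF x', symmetric]
      by (auto intro!: derivative_eq_intros f2_deriv[OF x'] w[OF x] u'[OF x]
          simp: algebra_simps power2_eq_square)
  qed (use X x du in auto)
  show "solves_linear_ode2 X ca cb (\<lambda>x. exp (- U x))"
    unfolding solves_linear_ode2_def u_def[abs_def, symmetric]
  proof (intro ballI conjI)
    fix x assume x: "x \<in> X"
    show "u field_differentiable at x" "deriv u field_differentiable at x"
      using u'[OF x] ddu[OF x] field_differentiable_def by blast+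
    show "deriv (deriv u) x + ca x * deriv u x + cb x * u x = 0"
      using du[OF x] DERIV_imp_deriv[OF ddu[OF x]] by simp
  qed
  show "w x = hs_w_of_u P h p1 \<epsilon> (\<lambda>x. exp (- U x)) x" if "x \<in> X" for x
    using du[OF that] f2_nonzero[of x] that X
    unfolding hs_w_of_u_def u_def[abs_def, symmetric] by (auto simp: u_def)
qed

text \<open>In the quotient rule the terms with a cancel because f2' = - a f2, and b / f2 = f0
  remains.\<close>

lemma linear_imp_riccati:
  assumes u: "solves_linear_ode2 X ca cb u" "u x \<noteq> 0" and x: "x \<in> X" "x \<in> hs_regular_x P h p1"
  shows "(hs_w_of_u P h p1 \<epsilon> u has_real_derivative
    f2 x * (hs_w_of_u P h p1 \<epsilon> u x)\<^sup>2 + f0 x) (at x)"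
proof -
  have nz: "u x \<noteq> 0" "f2 x \<noteq> 0"
    using u f2_nonzero x by auto
  have u': "(u has_real_derivative deriv u x) (at x)"
    and u'': "(deriv u has_real_derivative - ca x * deriv u x - cb x * u x) (at x)"
    using u(1) x(1) unfolding solves_linear_ode2_def
    by (metis DERIV_deriv_iff_field_differentiable)
      (smt (verit) DERIV_deriv_iff_field_differentiable mult_minus_left solves_linear_ode2_def u(1) x(1))
  have "(hs_w_of_u P h p1 \<epsilon> u has_real_derivative
      (- (- ca x * deriv u x - cb x * u x) * (f2 x * u x)
        + deriv u x * (- ca x * f2 x * u x + f2 x * deriv u x)) / (f2 x * u x)\<^sup>2) (at x)"
    unfolding hs_w_of_u_def[abs_def] using nz
    by (auto intro!: derivative_eq_intros f2_deriv[OF x(2)] u' u'' simp: power2_eq_square)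
      (simp add: field_simps)
  moreover have "(- (- ca x * deriv u x - cb x * u x) * (f2 x * u x)
        + deriv u x * (- ca x * f2 x * u x + f2 x * deriv u x)) / (f2 x * u x)\<^sup>2
      = f2 x * (hs_w_of_u P h p1 \<epsilon> u x)\<^sup>2 + f0 x"
    unfolding f2_f0[OF x(2), symmetric] hs_w_of_u_def
    using nz by (simp add: field_simps power2_eq_square)
  ultimately show ?thesis by simp
qed

end

end

section \<open>Motions on an interval of regular times, with the polar radius as independent
  variable\<close>

locale regular_motion = reduced_motion +
  assumes open_T: "open T" and interval_T: "is_interval T"
    and regular: "t \<in> T \<Longrightarrow> x t \<in> hs_regular_x P h p1" "t \<in> T \<Longrightarrow> y t \<noteq> - x t"
begin

lemma x_pos: "t \<in> T \<Longrightarrow> x t > 0" and P6_neg: "t \<in> T \<Longrightarrow> P6 (x t) < 0"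
  using regular(1) by (auto simp: hs_regular_x_def)

lemma m_nonzero: "t \<in> T \<Longrightarrow> m t \<noteq> 0"
  using m_sq[of t] P6_neg[of t] by auto

text \<open>By the intermediate value theorem m keeps its sign on the interval, so one branch of the
  root serves throughout.\<close>

lemma m_sign: "\<exists>\<epsilon>\<in>{1, -1}. \<forall>t\<in>T. m t = \<epsilon> * sqrt (- P6 (x t)) / 2"
proof -
  have abs: "sqrt (- P6 (x t)) = 2 * \<bar>m t\<bar>" if "t \<in> T" for t
    by (simp add: m_sq[OF that, symmetric] real_sqrt_mult)
  have "is_interval (m ` T)"
    using interval_T connected_continuous_image[OF continuous_coordinates(4)]
    by (simp add: is_interval_connected_1)
  moreover have "0 \<notin> m ` T"
    using m_nonzero by auto
  ultimately have "(\<forall>t\<in>T. m t > 0) \<or> (\<forall>t\<in>T. m t < 0)"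
    using m_nonzero mem_is_interval_1_I[of "m ` T" _ _ 0]
    by (meson image_eqI linorder_neqE_linordered_idom order_less_imp_le)
  then show ?thesis
  proof
    assume "\<forall>t\<in>T. m t > 0"
    then show ?thesis
      by (intro bexI[of _ 1]) (auto simp: abs)
  next
    assume "\<forall>t\<in>T. m t < 0"
    then show ?thesis
      by (intro bexI[of _ "-1"]) (auto simp: abs)
  qed
qed

text \<open>By Rolle's theorem a repeated value of x would produce a zero of m.\<close>

lemma inj_x: "inj_on x T"
proof -
  have False if ab: "a \<in> T" "b \<in> T" "a < b" "x a = x b" for a b
  proof -
    have sub: "s \<in> T" if "a \<le> s" "s \<le> b" for s
      using mem_is_interval_1_I[OF interval_T ab(1,2)] that by blast
    note deriv = x_deriv[OF sub x_pos[OF sub]]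
    have "\<exists>s. a < s \<and> s < b \<and> (x has_real_derivative 0) (at s)"
    proof (rule Rolle[OF ab(3,4)])
      show "continuous_on {a..b} x"
        by (rule continuous_on_subset[OF continuous_coordinates(5)]) (use sub in auto)
      show "x differentiable (at s)" if "a < s" "s < b" for s
        using deriv[of s] that real_differentiable_def by fastforce
    qed
    then obtain s where s: "a < s" "s < b" "(x has_real_derivative 0) (at s)" by blast
    then have "- (\<sigma> * m s / x s) = 0"
      using DERIV_unique[OF deriv] by fastforce
    then show False
      using m_nonzero[of s] x_pos[of s] sub[of s] s \<sigma>_pos by auto
  qed
  then show ?thesis
    by (metis inj_onI linorder_neqE_linordered_idom)
qed

lemma open_image: "open (x ` T)"
  by (rule invariance_of_domain[OF continuous_coordinates(5) open_T inj_x])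

lemma interval_image: "is_interval (x ` T)"
  using interval_T connected_continuous_image[OF continuous_coordinates(5)]
  by (simp add: is_interval_connected_1)

lemma image_regular: "x ` T \<subseteq> hs_regular_x P h p1"
  using regular(1) by blast

text \<open>The inverse of the radius, through which functions of time become functions of
  x.\<close>

definition "time = inv_into T x"

lemma time_x: "t \<in> T \<Longrightarrow> time (x t) = t"
  by (simp add: time_def inj_x)

lemma time_deriv:
  assumes t: "t \<in> T"
  shows "(time has_real_derivative - (x t / (\<sigma> * m t))) (at (x t))"
proof -
  have nz: "\<sigma> * m t \<noteq> 0" "x t \<noteq> 0"
    using m_nonzero[OF t] x_pos[OF t] \<sigma>_pos by auto
  have "(time has_derivative (*) (- (x t / (\<sigma> * m t)))) (at (x t))"
  proof (rule has_derivative_inverse_strong[OF open_T t continuous_coordinates(5) time_x])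
    show "(x has_derivative (*) (- (\<sigma> * m t / x t))) (at t)"
      using x_deriv[OF t x_pos[OF t]] by (simp add: has_field_derivative_def)
    show "(*) (- (\<sigma> * m t / x t)) \<circ> (*) (- (x t / (\<sigma> * m t))) = id"
      using nz by (auto simp: fun_eq_iff)
  qed
  then show ?thesis
    by (simp add: has_field_derivative_def)
qed

definition "tan_half t = z t / (x t + y t)"

lemma sum_nonzero: "t \<in> T \<Longrightarrow> x t + y t \<noteq> 0"
  using regular(2)[of t] by auto

lemma polar_arctan:
  assumes t: "t \<in> T"
  shows "y t = x t * cos (2 * arctan (tan_half t))" "z t = x t * sin (2 * arctan (tan_half t))"
proof -
  have nz: "x t + y t \<noteq> 0" "x t \<noteq> 0"
    using sum_nonzero[OF t] x_pos[OF t] by auto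
  have "1 + (tan_half t)\<^sup>2 = ((x t + y t)\<^sup>2 + (z t)\<^sup>2) / (x t + y t)\<^sup>2"
    "1 - (tan_half t)\<^sup>2 = ((x t + y t)\<^sup>2 - (z t)\<^sup>2) / (x t + y t)\<^sup>2"
    using nz by (simp_all add: tan_half_def power_divide add_divide_distrib diff_divide_distrib)
  moreover have "(x t + y t)\<^sup>2 + (z t)\<^sup>2 = 2 * x t * (x t + y t)"
    "(x t + y t)\<^sup>2 - (z t)\<^sup>2 = 2 * y t * (x t + y t)"
    using x_sq[of t] by algebra+
  ultimately have "1 + (tan_half t)\<^sup>2 = 2 * x t / (x t + y t)"
    "1 - (tan_half t)\<^sup>2 = 2 * y t / (x t + y t)"
    using nz by (simp_all add: power2_eq_square)
  then show "y t = x t * cos (2 * arctan (tan_half t))" "z t = x t * sin (2 * arctan (tan_half t))"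
    unfolding cos_double_arctan sin_double_arctan using nz by (simp_all add: tan_half_def)
qed

text \<open>Removes the ambiguity of the angle: every choice of \<phi>, continuous or not, leads to
  the same w.\<close>

lemma tan_of_polar_angle:
  assumes t: "t \<in> T" and "y t = x t * cos \<phi>" "z t = x t * sin \<phi>"
  shows "tan (\<phi> / 2) = tan_half t"
proof -
  have "tan (\<phi> / 2) = sin \<phi> / (cos \<phi> + 1)"
    using tan_half[of "\<phi> / 2"] by simp
  also have "\<dots> = (x t * sin \<phi>) / (x t * (cos \<phi> + 1))"
    using x_pos[OF t] by simp
  also have "\<dots> = tan_half t"
    unfolding tan_half_def by (simp add: assms(2,3)[symmetric] distrib_left add.commute)
  finally show ?thesis .
qed

lemma continuous_tan_half_time: "continuous_on (x ` T) (\<lambda>\<xi>. tan_half (time \<xi>))"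
proof (rule continuous_on_compose2[of T tan_half])
  show "continuous_on T tan_half"
    unfolding tan_half_def[abs_def] by (intro continuous_intros continuous_coordinates) (use sum_nonzero in auto)
  show "continuous_on (x ` T) time"
    using time_deriv by (intro continuous_at_imp_continuous_on) (auto intro: DERIV_isCont)
qed (auto simp: time_x)

context
  fixes \<epsilon> :: real
  assumes \<epsilon>: "\<epsilon> \<in> {1, -1}" and m: "t \<in> T \<Longrightarrow> m t = \<epsilon> * sqrt (- P6 (x t)) / 2"
begin

lemma quadrature: "hs_quadrature P h p1 \<epsilon> T x"
  unfolding hs_quadrature_def \<sigma>_def[symmetric]
proof
  fix t assume t: "t \<in> T"
  have "- (\<sigma> * m t / x t) = \<sigma> * (- (\<epsilon> * sqrt (- P6 (x t))) / (2 * x t))"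
    unfolding m[OF t] by simp
  then show "(x has_real_derivative \<sigma> * (- (\<epsilon> * sqrt (- P6 (x t))) / (2 * x t))) (at t)"
    using x_deriv[OF t x_pos[OF t]] by metis
qed

lemma riccati:
  assumes "\<xi> \<in> x ` T"
  shows "((\<lambda>\<xi>. tan_half (time \<xi>)) has_real_derivative
    hs_f2 P h p1 \<epsilon> \<xi> * (tan_half (time \<xi>))\<^sup>2 + hs_f0 P h p1 \<epsilon> \<xi>) (at \<xi>)"
proof -
  from assms obtain t where t: "t \<in> T" "\<xi> = x t" by blast
  define S where "S = \<epsilon> * sqrt (- P6 (x t))"
  have nz: "S \<noteq> 0" "x t \<noteq> 0" "\<sigma> \<noteq> 0" and mS: "m t = S / 2"
    using m_nonzero[OF t(1)] m[OF t(1)] x_pos[OF t(1)] \<sigma>_pos by (auto simp: S_def)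
  have "((\<lambda>\<xi>. tan_half (time \<xi>)) has_real_derivative
      (\<sigma> * (P3 (x t) * (tan_half t)\<^sup>2 - Q3 (x t)) / (4 * (x t)\<^sup>2)) * - (x t / (\<sigma> * m t))) (at (x t))"
    using tan_half_deriv[OF t(1) x_pos[OF t(1)] regular(2)[OF t(1)]] time_deriv[OF t(1)]
    unfolding tan_half_def[abs_def] by (intro DERIV_chain2) (simp_all add: time_x t)
  \<comment> \<open>Dividing dw/dt by dx/dt = - \<sigma> m / x cancels the time scale, and m = S / 2
    puts the root into the denominators of \<open>hs_f2\<close> and \<open>hs_f0\<close>.\<close>
  moreover have "(\<sigma> * (P3 (x t) * (tan_half t)\<^sup>2 - Q3 (x t)) / (4 * (x t)\<^sup>2)) * - (x t / (\<sigma> * m t))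
      = hs_f2 P h p1 \<epsilon> (x t) * (tan_half t)\<^sup>2 + hs_f0 P h p1 \<epsilon> (x t)"
    unfolding hs_f2_def hs_f0_def S_def[symmetric] mS using nz
    by (simp add: field_simps power2_eq_square)
  ultimately show ?thesis
    using t by (simp add: time_x)
qed

end

end

lemma (in hess_sretensky_gyrostat) reduced_motion_of_motion:
  assumes "hs_motion P T \<omega> \<gamma>" and "hs_integrals P h p1 T \<omega> \<gamma>"
  shows "reduced_motion P T (\<lambda>t. hs_y P (\<omega> t)) (\<lambda>t. hs_z P (\<omega> t)) (\<lambda>t. comp1 P (\<gamma> t))
    (\<lambda>t. comp2 P (\<gamma> t)) (\<lambda>t. \<gamma> t $ 3) h p1"
proof unfold_locales
  show "(comp1 P (\<gamma> t))\<^sup>2 + (comp2 P (\<gamma> t))\<^sup>2 + (\<gamma> t $ 3)\<^sup>2 = 1" if "t \<in> T" for t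
    using assms(1) that norm_components[of "\<gamma> t"] by (simp add: hs_motion_def)
qed (use assms motion_imp_reduced_system in \<open>auto simp: hs_integrals_def\<close>)

lemma (in hess_sretensky_gyrostat) reduction:
  assumes motion: "hs_motion P J \<omega> \<gamma>" and integrals: "hs_integrals P h p1 J \<omega> \<gamma>"
    and J: "open J" "is_interval J" "J \<noteq> {}" "J \<subseteq> hs_regular_times P h p1 T \<omega>"
  shows "hs_reduction P h p1 J \<omega> \<gamma>"
proof -
  interpret reduced_motion P J "\<lambda>t. hs_y P (\<omega> t)" "\<lambda>t. hs_z P (\<omega> t)" "\<lambda>t. comp1 P (\<gamma> t)"
    "\<lambda>t. comp2 P (\<gamma> t)" "\<lambda>t. \<gamma> t $ 3" h p1
    by (rule reduced_motion_of_motion[OF motion integrals])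
  have x: "x = (\<lambda>t. hs_x P (\<omega> t))"
    by (simp add: x_def[abs_def] hs_x_def[abs_def])
  interpret regular_motion P J "\<lambda>t. hs_y P (\<omega> t)" "\<lambda>t. hs_z P (\<omega> t)" "\<lambda>t. comp1 P (\<gamma> t)"
    "\<lambda>t. comp2 P (\<gamma> t)" "\<lambda>t. \<gamma> t $ 3" h p1
    by unfold_locales (use J in \<open>auto simp: x hs_regular_times_def\<close>)
  obtain \<epsilon> where \<epsilon>: "\<epsilon> \<in> {1, -1}" and m: "\<And>t. t \<in> J \<Longrightarrow> m t = \<epsilon> * sqrt (- P6 (x t)) / 2"
    using m_sign by blast
  let ?X = "x ` J"
  have "\<exists>\<phi>. continuous_on ?X \<phi> \<and> hs_polar_angle P J \<omega> \<phi>"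
  proof (intro exI conjI)
    show "continuous_on ?X (\<lambda>\<xi>. 2 * arctan (tan_half (time \<xi>)))"
      by (intro continuous_intros continuous_tan_half_time)
    show "hs_polar_angle P J \<omega> (\<lambda>\<xi>. 2 * arctan (tan_half (time \<xi>)))"
      unfolding hs_polar_angle_def x[THEN fun_cong, symmetric]
      using polar_arctan by (simp add: time_x)
  qed
  moreover have "(\<forall>\<xi>\<in>?X. ((\<lambda>\<xi>. tan (\<phi> \<xi> / 2)) has_real_derivative
        hs_f2 P h p1 \<epsilon> \<xi> * (tan (\<phi> \<xi> / 2))\<^sup>2 + hs_f0 P h p1 \<epsilon> \<xi>) (at \<xi>)) \<and>
      (\<exists>U. \<forall>\<xi>\<in>?X. (U has_real_derivative hs_f2 P h p1 \<epsilon> \<xi> * tan (\<phi> \<xi> / 2)) (at \<xi>)) \<and>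
      (\<forall>U. (\<forall>\<xi>\<in>?X. (U has_real_derivative hs_f2 P h p1 \<epsilon> \<xi> * tan (\<phi> \<xi> / 2)) (at \<xi>)) \<longrightarrow>
        solves_linear_ode2 ?X (hs_coeff_a P h p1) (hs_coeff_b P h p1) (\<lambda>\<xi>. exp (- U \<xi>)) \<and>
        (\<forall>\<xi>\<in>?X. tan (\<phi> \<xi> / 2) = hs_w_of_u P h p1 \<epsilon> (\<lambda>\<xi>. exp (- U \<xi>)) \<xi>) \<and>
        hs_recovered P h p1 \<epsilon> (\<lambda>\<xi>. exp (- U \<xi>)) J x \<omega> \<gamma>)"
    if \<phi>: "hs_polar_angle P J \<omega> \<phi>" for \<phi>
  proof -
    define w where "w \<xi> = tan (\<phi> \<xi> / 2)" for \<xi>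
    have w: "w \<xi> = tan_half (time \<xi>)" if "\<xi> \<in> ?X" for \<xi>
      using that \<phi> tan_of_polar_angle unfolding hs_polar_angle_def x[THEN fun_cong, symmetric]
      by (auto simp: w_def time_x)
    \<comment> \<open>\<phi> is prescribed only on \<open>?X\<close>; since \<open>?X\<close> is
      open, w still inherits the derivative of \<open>tan_half (time \<xi>)\<close>.\<close>
    have ric: "(w has_real_derivative hs_f2 P h p1 \<epsilon> \<xi> * (w \<xi>)\<^sup>2 + hs_f0 P h p1 \<epsilon> \<xi>) (at \<xi>)"
      if \<xi>: "\<xi> \<in> ?X" for \<xi>
      unfolding w[OF \<xi>]
      by (rule has_field_derivative_transform_within_open[OF riccati[OF \<epsilon> m \<xi>] open_image \<xi>])
        (simp_all add: w)
    have "continuous_on ?X w"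
      using ric by (intro continuous_at_imp_continuous_on) (auto intro: DERIV_isCont)
    then have "\<exists>U. \<forall>\<xi>\<in>?X. (U has_real_derivative hs_f2 P h p1 \<epsilon> \<xi> * w \<xi>) (at \<xi>)"
      by (intro primitive_on_open_interval open_image interval_image continuous_on_mult
          continuous_on_f2[OF \<epsilon>] image_regular)
    moreover have "solves_linear_ode2 ?X (hs_coeff_a P h p1) (hs_coeff_b P h p1) (\<lambda>\<xi>. exp (- U \<xi>)) \<and>
        (\<forall>\<xi>\<in>?X. w \<xi> = hs_w_of_u P h p1 \<epsilon> (\<lambda>\<xi>. exp (- U \<xi>)) \<xi>) \<and>
        hs_recovered P h p1 \<epsilon> (\<lambda>\<xi>. exp (- U \<xi>)) J x \<omega> \<gamma>"
      if U: "\<forall>\<xi>\<in>?X. (U has_real_derivative hs_f2 P h p1 \<epsilon> \<xi> * w \<xi>) (at \<xi>)" for U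
    proof -
      note lin = riccati_imp_linear[OF \<epsilon> open_image image_regular ric bspec[OF U]]
      have "hs_w_of_u P h p1 \<epsilon> (\<lambda>\<xi>. exp (- U \<xi>)) (x t) = tan_half t" if "t \<in> J" for t
        using lin(2)[of "x t"] w[of "x t"] that by (simp add: time_x)
      then show ?thesis
        using lin motion integrals polar_arctan by (simp add: hs_recovered_def)
    qed
    ultimately show ?thesis
      using ric unfolding w_def by blast
  qed
  ultimately show ?thesis
    using inj_x open_image interval_image \<epsilon> quadrature[OF \<epsilon> m]
    unfolding hs_reduction_def Let_def x by blast
qed

subsection \<open>Recovering the motion from a solution of the linear equation\<close>

text \<open>The quotient rule with the quotient itself kept as a term. For n2 and n3, which are
  quotients by the squared radius, the remaining condition is then a polynomial identity in n2 and
  n3.\<close>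

lemma DERIV_quotient_eq:
  fixes f g :: "real \<Rightarrow> real"
  assumes "(f has_real_derivative f') (at t)" "(g has_real_derivative g') (at t)" "g t \<noteq> 0"
    and "f' - g' * (f t / g t) = g t * D"
  shows "((\<lambda>t. f t / g t) has_real_derivative D) (at t)"
proof -
  have f': "f' = g t * D + g' * (f t / g t)"
    using assms(4) by simp
  have "((\<lambda>t. f t / g t) has_real_derivative (f' * g t - f t * g') / (g t * g t)) (at t)"
    using DERIV_divide[OF assms(1-3)] .
  moreover have "(f' * g t - f t * g') / (g t * g t) = D"
    unfolding f' using assms(3) by (simp add: field_simps)
  ultimately show ?thesis by simp
qed

context hess_sretensky_gyrostat
begin

text \<open>All components are forced: the energy integral yields n1, the quadrature yields m, the
  area integral yields r. The same \<epsilon> in the quadrature and in \<open>hs_f2\<close>,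
  \<open>hs_f0\<close> makes the root cancel from dw/dt.\<close>

lemma recovered_exists:
  assumes \<epsilon>: "\<epsilon> \<in> {1, -1}" and X: "X \<subseteq> hs_regular_x P h p1"
    and u: "solves_linear_ode2 X (hs_coeff_a P h p1) (hs_coeff_b P h p1) u" "\<And>x. x \<in> X \<Longrightarrow> u x \<noteq> 0"
    and \<xi>: "\<xi> ` J \<subseteq> X" "hs_quadrature P h p1 \<epsilon> J \<xi>"
  shows "\<exists>\<omega> \<gamma>. hs_recovered P h p1 \<epsilon> u J \<xi> \<omega> \<gamma>"
proof -
  define w where "w t = hs_w_of_u P h p1 \<epsilon> u (\<xi> t)" for t
  define y where "y t = \<xi> t * cos (2 * arctan (w t))" for t
  define z where "z t = \<xi> t * sin (2 * arctan (w t))" for t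
  define n1 where "n1 t = h - (\<xi> t)\<^sup>2 / 2" for t
  define m where "m t = \<epsilon> * sqrt (- hs_P6 P h p1 (\<xi> t)) / 2" for t
  define r where "r t = p1 - B * n1 t" for t
  \<comment> \<open>n2 and n3 solve y n2 + z n3 = r and z n2 - y n3 = m, whose matrix is orthogonal
    up to the factor \<xi>.\<close>
  define n2 where "n2 t = (y t * r t + z t * m t) / (\<xi> t)\<^sup>2" for t
  define n3 where "n3 t = (z t * r t - y t * m t) / (\<xi> t)\<^sup>2" for t
  define k where "k t = d * y t + A - B" for t
  \<comment> \<open>Half the derivative of the cubic for m^2 with respect to n1, hence the rate of m
    in dimensionless time.\<close>
  define N where "N t = B * r t - (\<xi> t)\<^sup>2 * n1 t - (1 - (n1 t)\<^sup>2)" for t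
  have yz: "(y t)\<^sup>2 + (z t)\<^sup>2 = (\<xi> t)\<^sup>2" for t
    by (simp add: y_def z_def power_mult_distrib distrib_left[symmetric])
  have reg: "\<xi> t \<in> hs_regular_x P h p1" if "t \<in> J" for t
    using that X \<xi>(1) by blast
  have nz: "\<xi> t > 0" "m t \<noteq> 0" if "t \<in> J" for t
    using branch_nonzero[OF \<epsilon> reg[OF that]] reg[OF that] by (auto simp: m_def hs_regular_x_def)
  have n23: "(\<xi> t)\<^sup>2 * n2 t = y t * r t + z t * m t" "(\<xi> t)\<^sup>2 * n3 t = z t * r t - y t * m t"
    if "t \<in> J" for t
    using nz(1)[OF that] by (simp_all add: n2_def n3_def)
  \<comment> \<open>This identity is the definition of \<open>hs_P6\<close> read backwards; it is
    what makes the vertical vector have length 1.\<close>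
  have rm: "(r t)\<^sup>2 + (m t)\<^sup>2 = (\<xi> t)\<^sup>2 * (1 - (n1 t)\<^sup>2)" if "t \<in> J" for t
  proof -
    have "4 * (m t)\<^sup>2 = - hs_P6 P h p1 (\<xi> t)"
      using branch_sq[OF \<epsilon> reg[OF that]] by (simp add: m_def power_divide)
    then show ?thesis
      unfolding r_def n1_def hs_P6_def by (simp add: field_simps eval_nat_numeral)
  qed
  have rot: "n3 t * r t + n2 t * m t = z t * (1 - (n1 t)\<^sup>2)"
    "n2 t * r t - n3 t * m t = y t * (1 - (n1 t)\<^sup>2)"
    "y t * n2 t + z t * n3 t = r t" "z t * n2 t - y t * n3 t = m t" if t: "t \<in> J" for t
  proof -
    have "(\<xi> t)\<^sup>2 * (n3 t * r t + n2 t * m t) = (\<xi> t)\<^sup>2 * (z t * (1 - (n1 t)\<^sup>2))"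
      "(\<xi> t)\<^sup>2 * (n2 t * r t - n3 t * m t) = (\<xi> t)\<^sup>2 * (y t * (1 - (n1 t)\<^sup>2))"
      "(\<xi> t)\<^sup>2 * (y t * n2 t + z t * n3 t) = (\<xi> t)\<^sup>2 * r t"
      "(\<xi> t)\<^sup>2 * (z t * n2 t - y t * n3 t) = (\<xi> t)\<^sup>2 * m t"
      using n23[OF t] rm[OF t] yz[of t] by algebra+
    then show "n3 t * r t + n2 t * m t = z t * (1 - (n1 t)\<^sup>2)"
      "n2 t * r t - n3 t * m t = y t * (1 - (n1 t)\<^sup>2)"
      "y t * n2 t + z t * n3 t = r t" "z t * n2 t - y t * n3 t = m t"
      using nz(1)[OF t] by simp_all
  qed
  have unit: "(n1 t)\<^sup>2 + (n2 t)\<^sup>2 + (n3 t)\<^sup>2 = 1" if t: "t \<in> J" for t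
  proof -
    have "(\<xi> t)\<^sup>2 * ((n2 t)\<^sup>2 + (n3 t)\<^sup>2) = (\<xi> t)\<^sup>2 * (1 - (n1 t)\<^sup>2)"
      using rot[OF t] yz[of t] n23[OF t] by algebra
    then show ?thesis
      using nz(1)[OF t] by simp
  qed
  have \<xi>': "(\<xi> has_real_derivative - (\<sigma> * m t / \<xi> t)) (at t)" if "t \<in> J" for t
    using \<xi>(2) that unfolding hs_quadrature_def \<sigma>_def[symmetric]
    by (simp add: m_def)
  have Q': "((\<lambda>t. (\<xi> t)\<^sup>2) has_real_derivative - (2 * \<sigma> * m t)) (at t)" if "t \<in> J" for t
    using DERIV_power[OF \<xi>'[OF that], of 2] nz(1)[OF that] by (simp add: mult.assoc)
  have n1': "(n1 has_real_derivative \<sigma> * m t) (at t)" if "t \<in> J" for t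
    using DERIV_diff[OF DERIV_const DERIV_cdivide[OF Q'[OF that], of 2], of h]
    by (simp add: n1_def[abs_def])
  have r': "(r has_real_derivative - B * (\<sigma> * m t)) (at t)" if "t \<in> J" for t
    unfolding r_def[abs_def] by (auto intro!: derivative_eq_intros n1'[OF that])
  have m': "(m has_real_derivative \<sigma> * N t) (at t)" if t: "t \<in> J" for t
  proof -
    let ?q = "3 * (\<xi> t)^5 + 2 * (B\<^sup>2 - 4 * h) * (\<xi> t)^3 + 4 * (h\<^sup>2 - 1 - B * (B * h - p1)) * \<xi> t"
    have "(m has_real_derivative - ?q / (2 * m t) * - (\<sigma> * m t / \<xi> t) / 2) (at t)"
      using DERIV_chain2[OF branch_deriv[OF \<epsilon> reg[OF t]] \<xi>'[OF t]]
      unfolding m_def[abs_def] by (intro DERIV_cdivide) simp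
    moreover have "- ?q / (2 * m t) * - (\<sigma> * m t / \<xi> t) / 2 = \<sigma> * N t"
      using nz[OF t] by (simp add: N_def r_def n1_def field_simps eval_nat_numeral)
    ultimately show ?thesis by simp
  qed
  have w': "(w has_real_derivative
      \<sigma> * (hs_P3 P h p1 (\<xi> t) * (w t)\<^sup>2 - hs_Q3 P h p1 (\<xi> t)) / (4 * (\<xi> t)\<^sup>2)) (at t)"
    if t: "t \<in> J" for t
  proof -
    have "\<xi> t \<in> X"
      using \<xi>(1) t by blast
    have "(w has_real_derivative
        (hs_f2 P h p1 \<epsilon> (\<xi> t) * (w t)\<^sup>2 + hs_f0 P h p1 \<epsilon> (\<xi> t)) * - (\<sigma> * m t / \<xi> t)) (at t)"
      unfolding w_def[abs_def]
      by (rule DERIV_chain2[OF linear_imp_riccati[OF \<epsilon> u(1) u(2) _ reg[OF t]] \<xi>'[OF t]]) fact+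
    moreover have f: "hs_f2 P h p1 \<epsilon> (\<xi> t) = - hs_P3 P h p1 (\<xi> t) / (4 * \<xi> t * m t)"
      "hs_f0 P h p1 \<epsilon> (\<xi> t) = hs_Q3 P h p1 (\<xi> t) / (4 * \<xi> t * m t)"
      by (simp_all add: hs_f2_def hs_f0_def m_def)
    have "(hs_f2 P h p1 \<epsilon> (\<xi> t) * (w t)\<^sup>2 + hs_f0 P h p1 \<epsilon> (\<xi> t)) * - (\<sigma> * m t / \<xi> t)
        = \<sigma> * (hs_P3 P h p1 (\<xi> t) * (w t)\<^sup>2 - hs_Q3 P h p1 (\<xi> t)) / (4 * (\<xi> t)\<^sup>2)"
      unfolding f using nz[OF t] by (simp add: field_simps power2_eq_square)
    ultimately show ?thesis by metis
  qed
  have \<phi>': "((\<lambda>t. 2 * arctan (w t)) has_real_derivative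
      - \<sigma> * (k t + r t / (\<xi> t)\<^sup>2)) (at t)" if t: "t \<in> J" for t
  proof -
    \<comment> \<open>w enters only through this denominator of
      \<open>cos (2 * arctan (w t))\<close>.\<close>
    define V where "V = 1 + (w t)\<^sup>2"
    have V: "(w t)\<^sup>2 = V - 1" "V \<noteq> 0"
      using zero_le_power2[of "w t"] by (auto simp: V_def add_nonneg_eq_0_iff)
    have "((\<lambda>t. 2 * arctan (w t)) has_real_derivative 2 * (inverse (1 + (w t)\<^sup>2) *
        (\<sigma> * (hs_P3 P h p1 (\<xi> t) * (w t)\<^sup>2 - hs_Q3 P h p1 (\<xi> t)) / (4 * (\<xi> t)\<^sup>2)))) (at t)"
      by (intro DERIV_cmult DERIV_chain2[OF DERIV_arctan w'[OF t]])
    moreover have "2 * (inverse (1 + (w t)\<^sup>2) *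
        (\<sigma> * (hs_P3 P h p1 (\<xi> t) * (w t)\<^sup>2 - hs_Q3 P h p1 (\<xi> t)) / (4 * (\<xi> t)\<^sup>2)))
        = - \<sigma> * (k t + r t / (\<xi> t)\<^sup>2)"
      unfolding hs_Q3_def hs_P3_def k_def r_def n1_def y_def cos_double_arctan V(1)
      using nz[OF t] V(2)
      by (simp add: field_simps power2_eq_square power3_eq_cube)
    ultimately show ?thesis by simp
  qed
  have y': "(y has_real_derivative \<sigma> * (z t * k t + n3 t)) (at t)" if t: "t \<in> J" for t
  proof -
    have "- (\<sigma> * m t / \<xi> t) * cos (2 * arctan (w t))
        + - sin (2 * arctan (w t)) * (- \<sigma> * (k t + r t / (\<xi> t)\<^sup>2)) * \<xi> t
        = \<sigma> * (z t * k t + n3 t)"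
      using nz[OF t] by (simp add: y_def z_def n3_def field_simps power2_eq_square)
    then show ?thesis
      using DERIV_mult[OF \<xi>'[OF t] DERIV_chain2[OF DERIV_cos \<phi>'[OF t]]]
      unfolding y_def[abs_def] by metis
  qed
  have z': "(z has_real_derivative \<sigma> * (- y t * k t - n2 t)) (at t)" if t: "t \<in> J" for t
  proof -
    have "- (\<sigma> * m t / \<xi> t) * sin (2 * arctan (w t))
        + cos (2 * arctan (w t)) * (- \<sigma> * (k t + r t / (\<xi> t)\<^sup>2)) * \<xi> t
        = \<sigma> * (- y t * k t - n2 t)"
      using nz[OF t] by (simp add: y_def z_def n2_def field_simps power2_eq_square)
    then show ?thesis
      using DERIV_mult[OF \<xi>'[OF t] DERIV_chain2[OF DERIV_sin \<phi>'[OF t]]]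
      unfolding z_def[abs_def] by metis
  qed
  \<comment> \<open>\<open>k t + B\<close> is \<open>d * y t + A\<close>, the dimensionless first
    component of the angular velocity.\<close>
  have n2': "(n2 has_real_derivative \<sigma> * ((k t + B) * n3 t - z t * n1 t)) (at t)"
    if t: "t \<in> J" for t
    unfolding n2_def[abs_def]
  proof (rule DERIV_quotient_eq[OF _ Q'[OF t]])
    show "((\<lambda>t. y t * r t + z t * m t) has_real_derivative
        \<sigma> * (z t * k t + n3 t) * r t + - B * (\<sigma> * m t) * y t
        + (\<sigma> * (- y t * k t - n2 t) * m t + \<sigma> * N t * z t)) (at t)"
      by (intro DERIV_add DERIV_mult y'[OF t] z'[OF t] r'[OF t] m'[OF t])
    show "\<sigma> * (z t * k t + n3 t) * r t + - B * (\<sigma> * m t) * y t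
        + (\<sigma> * (- y t * k t - n2 t) * m t + \<sigma> * N t * z t)
        - - (2 * \<sigma> * m t) * ((y t * r t + z t * m t) / (\<xi> t)\<^sup>2)
        = (\<xi> t)\<^sup>2 * (\<sigma> * ((k t + B) * n3 t - z t * n1 t))"
      unfolding n2_def[symmetric] N_def using rot[OF t] n23[OF t] by algebra
  qed (use nz[OF t] in auto)
  have n3': "(n3 has_real_derivative \<sigma> * (y t * n1 t - (k t + B) * n2 t)) (at t)"
    if t: "t \<in> J" for t
    unfolding n3_def[abs_def]
  proof (rule DERIV_quotient_eq[OF _ Q'[OF t]])
    show "((\<lambda>t. z t * r t - y t * m t) has_real_derivative
        \<sigma> * (- y t * k t - n2 t) * r t + - B * (\<sigma> * m t) * z t
        - (\<sigma> * (z t * k t + n3 t) * m t + \<sigma> * N t * y t)) (at t)"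
      by (intro DERIV_diff DERIV_mult y'[OF t] z'[OF t] r'[OF t] m'[OF t])
    show "\<sigma> * (- y t * k t - n2 t) * r t + - B * (\<sigma> * m t) * z t
        - (\<sigma> * (z t * k t + n3 t) * m t + \<sigma> * N t * y t)
        - - (2 * \<sigma> * m t) * ((z t * r t - y t * m t) / (\<xi> t)\<^sup>2)
        = (\<xi> t)\<^sup>2 * (\<sigma> * (y t * n1 t - (k t + B) * n2 t))"
      unfolding n3_def[symmetric] N_def using rot[OF t] n23[OF t] by algebra
  qed (use nz[OF t] in auto)
  have "reduced_system \<sigma> d A B J y z n1 n2 n3"
    unfolding reduced_system_def
  proof (intro ballI conjI)
    fix t assume t: "t \<in> J"
    show "(y has_real_derivative \<sigma> * (d * y t * z t + (A - B) * z t + n3 t)) (at t)"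
      using y'[OF t] by (simp add: k_def algebra_simps)
    show "(z has_real_derivative \<sigma> * (- d * (y t)\<^sup>2 - (A - B) * y t - n2 t)) (at t)"
      using z'[OF t] by (simp add: k_def algebra_simps power2_eq_square)
    show "(n1 has_real_derivative \<sigma> * (z t * n2 t - y t * n3 t)) (at t)"
      using n1'[OF t] rot(4)[OF t] by simp
    show "(n2 has_real_derivative \<sigma> * (d * y t * n3 t - z t * n1 t + A * n3 t)) (at t)"
      using n2'[OF t] by (simp add: k_def algebra_simps)
    show "(n3 has_real_derivative \<sigma> * (- d * y t * n2 t + y t * n1 t - A * n2 t)) (at t)"
      using n3'[OF t] by (simp add: k_def algebra_simps)
  qed
  note motion = reduced_system_imp_motion[OF this unit]
  have "hs_recovered P h p1 \<epsilon> u J \<xi> (\<lambda>t. angular_velocity (y t) (z t))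
      (\<lambda>t. of_components (n1 t) (n2 t) (n3 t))"
    unfolding hs_recovered_def hs_integrals_def
    using motion rot(3) by (simp add: angular_velocity of_components yz)
      (simp add: n1_def r_def y_def z_def w_def)
  then show ?thesis by blast
qed

text \<open>(y, z) fixes the angular velocity and the energy integral fixes n1. The area integral
  and the derivative of n1 then give two linear equations for (n2, n3), with determinant \<xi>^2 up
  to sign.\<close>

lemma recovered_unique:
  assumes J: "open J" and \<xi>: "\<And>t. t \<in> J \<Longrightarrow> \<xi> t > 0"
    and rec1: "hs_recovered P h p1 \<epsilon> u J \<xi> \<omega>1 \<gamma>1" and rec2: "hs_recovered P h p1 \<epsilon> u J \<xi> \<omega>2 \<gamma>2"
    and t: "t \<in> J"
  shows "\<omega>1 t = \<omega>2 t \<and> \<gamma>1 t = \<gamma>2 t"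
proof -
  let ?y = "\<lambda>t. hs_y P (\<omega>1 t)" and ?z = "\<lambda>t. hs_z P (\<omega>1 t)"
  have yz: "hs_y P (\<omega>2 s) = ?y s" "hs_z P (\<omega>2 s) = ?z s" if "s \<in> J" for s
    using rec1 rec2 that by (simp_all add: hs_recovered_def)
  have "\<omega>1 t = angular_velocity (?y t) (?z t)" "\<omega>2 t = angular_velocity (?y t) (?z t)"
    using rec1 rec2 angular_velocity_unique[of "\<omega>1 t"] angular_velocity_unique[of "\<omega>2 t"] t
    by (auto simp: hs_recovered_def hs_motion_def yz)
  then have \<omega>: "\<omega>1 t = \<omega>2 t" by simp
  have n1: "comp1 P (\<gamma>1 s) = comp1 P (\<gamma>2 s)" if "s \<in> J" for s
  proof -
    have "((?y s)\<^sup>2 + (?z s)\<^sup>2) / 2 + comp1 P (\<gamma>1 s) = h"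
      "((hs_y P (\<omega>2 s))\<^sup>2 + (hs_z P (\<omega>2 s))\<^sup>2) / 2 + comp1 P (\<gamma>2 s) = h"
      using rec1 rec2 that unfolding hs_recovered_def hs_integrals_def by blast+
    then show ?thesis
      by (simp add: yz[OF that])
  qed
  have area: "?y t * comp2 P (\<gamma>1 t) + ?z t * \<gamma>1 t $ 3 = ?y t * comp2 P (\<gamma>2 t) + ?z t * \<gamma>2 t $ 3"
    using rec1 rec2 t yz[OF t] n1[OF t] by (smt (verit) hs_recovered_def hs_integrals_def)
  have "((\<lambda>t. comp1 P (\<gamma>1 t)) has_real_derivative
      \<sigma> * (?z t * comp2 P (\<gamma>1 t) - ?y t * \<gamma>1 t $ 3)) (at t)"
    "((\<lambda>t. comp1 P (\<gamma>2 t)) has_real_derivative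
      \<sigma> * (?z t * comp2 P (\<gamma>2 t) - ?y t * \<gamma>2 t $ 3)) (at t)"
    using reduced_systemD(3)[OF motion_imp_reduced_system t] rec1 rec2 yz[OF t]
    unfolding hs_recovered_def by metis+
  \<comment> \<open>The two functions n1 agree on the open set J, so their derivatives agree
    too.\<close>
  moreover from this(2) have "((\<lambda>t. comp1 P (\<gamma>1 t)) has_real_derivative
      \<sigma> * (?z t * comp2 P (\<gamma>2 t) - ?y t * \<gamma>2 t $ 3)) (at t)"
    by (rule has_field_derivative_transform_within_open[OF _ J t]) (simp add: n1)
  ultimately have "\<sigma> * (?z t * comp2 P (\<gamma>1 t) - ?y t * \<gamma>1 t $ 3)
      = \<sigma> * (?z t * comp2 P (\<gamma>2 t) - ?y t * \<gamma>2 t $ 3)"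
    using DERIV_unique by blast
  then have rot: "?z t * comp2 P (\<gamma>1 t) - ?y t * \<gamma>1 t $ 3 = ?z t * comp2 P (\<gamma>2 t) - ?y t * \<gamma>2 t $ 3"
    using \<sigma>_pos by simp
  have "(?y t)\<^sup>2 + (?z t)\<^sup>2 = (\<xi> t)\<^sup>2"
    using rec1 t by (simp add: hs_recovered_def power_mult_distrib distrib_left[symmetric])
  then have nz: "(?y t)\<^sup>2 + (?z t)\<^sup>2 \<noteq> 0"
    using \<xi>[OF t] by simp
  have "((?y t)\<^sup>2 + (?z t)\<^sup>2) * comp2 P (\<gamma>1 t) = ((?y t)\<^sup>2 + (?z t)\<^sup>2) * comp2 P (\<gamma>2 t)"
    "((?y t)\<^sup>2 + (?z t)\<^sup>2) * \<gamma>1 t $ 3 = ((?y t)\<^sup>2 + (?z t)\<^sup>2) * \<gamma>2 t $ 3"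
    using area rot by algebra+
  then have "\<gamma>1 t = \<gamma>2 t"
    using nz n1[OF t] unfolding eq_iff_components[of "\<gamma>1 t"] by auto
  with \<omega> show ?thesis by simp
qed

end

theorem theorem1:
  fixes P :: gyrostat
  assumes "hess_sretensky P" and "hs_d1 P \<noteq> 0"
  shows
    "(\<forall>T \<omega> \<gamma>.
        open T \<and> is_interval T \<and> T \<noteq> {} \<and> hs_motion P T \<omega> \<gamma> \<and>
        \<not> (\<lambda>t. hs_x P (\<omega> t)) constant_on T \<longrightarrow>
        (\<exists>h p1. hs_integrals P h p1 T \<omega> \<gamma> \<and>
           open (hs_regular_times P h p1 T \<omega>) \<and>
           T \<subseteq> closure (hs_regular_times P h p1 T \<omega>) \<and>
           (\<forall>J. open J \<and> is_interval J \<and> J \<noteq> {} \<and> J \<subseteq> hs_regular_times P h p1 T \<omega> \<longrightarrow>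
              hs_reduction P h p1 J \<omega> \<gamma>))) \<and>
     (\<forall>h p1 \<epsilon> X u J \<xi>.
        \<epsilon> \<in> {1, -1} \<and>
        open X \<and> X \<subseteq> hs_regular_x P h p1 \<and>
        solves_linear_ode2 X (hs_coeff_a P h p1) (hs_coeff_b P h p1) u \<and> (\<forall>x\<in>X. u x \<noteq> 0) \<and>
        open J \<and> is_interval J \<and> J \<noteq> {} \<and> \<xi> ` J \<subseteq> X \<and> hs_quadrature P h p1 \<epsilon> J \<xi> \<longrightarrow>
        (\<exists>\<omega> \<gamma>. hs_recovered P h p1 \<epsilon> u J \<xi> \<omega> \<gamma>) \<and>
        (\<forall>\<omega>1 \<gamma>1 \<omega>2 \<gamma>2.
           hs_recovered P h p1 \<epsilon> u J \<xi> \<omega>1 \<gamma>1 \<and> hs_recovered P h p1 \<epsilon> u J \<xi> \<omega>2 \<gamma>2 \<longrightarrow>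
           (\<forall>t\<in>J. \<omega>1 t = \<omega>2 t \<and> \<gamma>1 t = \<gamma>2 t)))"
proof -
  interpret hess_sretensky_gyrostat P
    using assms by unfold_locales
  have part1: "\<exists>h p1. hs_integrals P h p1 T \<omega> \<gamma> \<and> open (hs_regular_times P h p1 T \<omega>) \<and>
      T \<subseteq> closure (hs_regular_times P h p1 T \<omega>) \<and>
      (\<forall>J. open J \<and> is_interval J \<and> J \<noteq> {} \<and> J \<subseteq> hs_regular_times P h p1 T \<omega> \<longrightarrow>
        hs_reduction P h p1 J \<omega> \<gamma>)"
    if T: "open T" "is_interval T" and motion: "hs_motion P T \<omega> \<gamma>"
      and nonconst: "\<not> (\<lambda>t. hs_x P (\<omega> t)) constant_on T" for T \<omega> \<gamma>
  proof -
    \<comment> \<open>The constants are found once on \<open>T\<close>, so a single pair serves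
      every subinterval J.\<close>
    obtain h p1 where integrals: "hs_integrals P h p1 T \<omega> \<gamma>"
      using first_integrals_exist[OF motion_imp_reduced_system[OF motion] T(2)]
      unfolding hs_integrals_def by metis
    interpret reduced_motion P T "\<lambda>t. hs_y P (\<omega> t)" "\<lambda>t. hs_z P (\<omega> t)" "\<lambda>t. comp1 P (\<gamma> t)"
      "\<lambda>t. comp2 P (\<gamma> t)" "\<lambda>t. \<gamma> t $ 3" h p1
      by (rule reduced_motion_of_motion[OF motion integrals])
    have x: "x = (\<lambda>t. hs_x P (\<omega> t))"
      by (simp add: x_def[abs_def] hs_x_def[abs_def])
    have times: "hs_regular_times P h p1 T \<omega> = regular_times"
      by (simp add: hs_regular_times_def regular_times_def x)
    have "hs_reduction P h p1 J \<omega> \<gamma>"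
      if J: "open J" "is_interval J" "J \<noteq> {}" "J \<subseteq> hs_regular_times P h p1 T \<omega>" for J
    proof (rule reduction[OF _ _ J])
      have "J \<subseteq> T"
        using J(4) by (auto simp: hs_regular_times_def)
      then show "hs_motion P J \<omega> \<gamma>" "hs_integrals P h p1 J \<omega> \<gamma>"
        using motion integrals
        unfolding hs_motion_def euler_poisson_def hs_integrals_def by (meson subsetD)+
    qed
    then show ?thesis
      using integrals open_regular_times[OF T(1)] regular_times_dense[OF T nonconst[folded x]]
      by (intro exI[of _ h] exI[of _ p1]) (simp add: times)
  qed
  have part2: "(\<exists>\<omega> \<gamma>. hs_recovered P h p1 \<epsilon> u J \<xi> \<omega> \<gamma>) \<and>
      (\<forall>\<omega>1 \<gamma>1 \<omega>2 \<gamma>2. hs_recovered P h p1 \<epsilon> u J \<xi> \<omega>1 \<gamma>1 \<and> hs_recovered P h p1 \<epsilon> u J \<xi> \<omega>2 \<gamma>2 \<longrightarrow>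
        (\<forall>t\<in>J. \<omega>1 t = \<omega>2 t \<and> \<gamma>1 t = \<gamma>2 t))"
    if "\<epsilon> \<in> {1, -1}" "X \<subseteq> hs_regular_x P h p1"
      "solves_linear_ode2 X (hs_coeff_a P h p1) (hs_coeff_b P h p1) u" "\<forall>x\<in>X. u x \<noteq> 0"
      "open J" "\<xi> ` J \<subseteq> X" "hs_quadrature P h p1 \<epsilon> J \<xi>" for h p1 \<epsilon> X u J \<xi>
  proof -
    have "\<xi> t > 0" if "t \<in> J" for t
      using that \<open>\<xi> ` J \<subseteq> X\<close> \<open>X \<subseteq> hs_regular_x P h p1\<close> by (auto simp: hs_regular_x_def)
    then have "\<forall>t\<in>J. \<omega>1 t = \<omega>2 t \<and> \<gamma>1 t = \<gamma>2 t"
      if "hs_recovered P h p1 \<epsilon> u J \<xi> \<omega>1 \<gamma>1 \<and> hs_recovered P h p1 \<epsilon> u J \<xi> \<omega>2 \<gamma>2" for \<omega>1 \<gamma>1 \<omega>2 \<gamma>2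
      using recovered_unique[OF \<open>open J\<close>] that by meson
    moreover have "\<exists>\<omega> \<gamma>. hs_recovered P h p1 \<epsilon> u J \<xi> \<omega> \<gamma>"
      by (rule recovered_exists[OF that(1-3) bspec[OF that(4)] that(6,7)])
    ultimately show ?thesis
      by blast
  qed
  show ?thesis
    by (rule conjI; intro allI impI; elim conjE) (rule part1 part2; assumption)+
qed

end
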